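(* Let $G$ be a connected finite simple graph. If $G$ has at least two cycles, then the matrices $B$ and $M$ associated with $G$ have the same Jordan canonical form (up to permutation of the Jordan blocks).
   Context: Let $G$ have vertex set $\{1,\dots,n\}$ and $m$ edges. "At least two cycles" means that $G$ contains at least two distinct cycles as subgraphs. Each edge $ij$ is regarded as a pair of directed edges $(i,j)$ and $(j,i)$. The non-backtracking matrix $B=B(G)$ is the $2m\times 2m$ matrix indexed by the directed edges, with $B_{(i,j),(k,l)}=1$ if $j=k$ and $i\neq l$, and $0$ otherwise. Let $A$ be the adjacency matrix and $D$ the diagonal matrix of degrees of $G$. Define the $2n\times 2n$ matrix $$K=K(G)=\begin{bmatrix} A & D-I_n\\ -I_n & 0\end{bmatrix}$$ and, for $m\ge n$, the $2m\times 2m$ block diagonal matrix $$M=\begin{bmatrix} K&0&0\\0&I_{m-n}&0\\0&0&-I_{m-n}\end{bmatrix}.$$ Jordan forms are taken over $\mathbb{C}$. *)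

theory Defs
  imports
    "Graph_Theory.Digraph_Component"
    "Jordan_Normal_Form.Jordan_Normal_Form"
begin

text \<open>
  Finite simple graphs are modelled by the library's \<^locale>\<open>pair_graph\<close>: finite, symmetric,
  loop-free sets of pairs. Thus \<open>parcs G\<close> is exactly the set of directed edges: every undirected
  edge \<open>ij\<close> occurs in it as the two pairs \<open>(i,j)\<close> and \<open>(j,i)\<close>. Vertices are the natural numbers
  \<open>1, \<dots>, n\<close>, whereas matrix indices start at 0; row and column \<open>i\<close> belong to vertex \<open>Suc i\<close>.
\<close>

definition num_edges :: "'a pair_pre_digraph \<Rightarrow> nat" where
  "num_edges G = card ((\<lambda>(u, v). {u, v}) ` parcs G)"

definition cycle_graph :: "'a list \<Rightarrow> 'a pair_pre_digraph" where
  "cycle_graph vs =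
     \<lparr> pverts = set vs,
       parcs = (\<Union>i<length vs. let u = vs ! i; v = vs ! (Suc i mod length vs) in {(u, v), (v, u)}) \<rparr>"

text \<open>
  The library's \<open>cycle\<close> is about directed closed walks: it admits \<open>u, v, u\<close> and distinguishes
  starting points and orientations. A cycle of an undirected graph is a subgraph instead, so two
  cycles are distinct iff they are distinct as graphs.
\<close>

definition cycle_subgraphs :: "'a pair_pre_digraph \<Rightarrow> 'a pair_pre_digraph set" where
  "cycle_subgraphs G =
     {cycle_graph vs | vs. distinct vs \<and> 3 \<le> length vs \<and>
        subgraph (with_proj (cycle_graph vs)) (with_proj G)}"

definition at_least_two_cycles :: "'a pair_pre_digraph \<Rightarrow> bool" where
  "at_least_two_cycles G \<longleftrightarrow>
     (\<exists>C\<^sub>1 \<in> cycle_subgraphs G. \<exists>C\<^sub>2 \<in> cycle_subgraphs G. C\<^sub>1 \<noteq> C\<^sub>2)"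

text \<open>The argument lists the directed edges in the order in which they index rows and columns.\<close>

definition nonbacktracking_matrix :: "('a \<times> 'a) list \<Rightarrow> complex mat" where
  "nonbacktracking_matrix es =
     mat (length es) (length es) (\<lambda>(p, q).
       case (es ! p, es ! q) of ((i, j), (k, l)) \<Rightarrow> if j = k \<and> i \<noteq> l then 1 else 0)"

definition adjacency_matrix :: "nat \<Rightarrow> nat pair_pre_digraph \<Rightarrow> complex mat" where
  "adjacency_matrix n G =
     mat n n (\<lambda>(i, j). if (Suc i, Suc j) \<in> parcs G then 1 else 0)"

definition degree_matrix :: "nat \<Rightarrow> nat pair_pre_digraph \<Rightarrow> complex mat" where
  "degree_matrix n G =
     mat n n (\<lambda>(i, j). if i = j then of_nat (out_degree (with_proj G) (Suc i)) else 0)"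

definition K_matrix :: "nat \<Rightarrow> nat pair_pre_digraph \<Rightarrow> complex mat" where
  "K_matrix n G =
     four_block_mat (adjacency_matrix n G) (degree_matrix n G - 1\<^sub>m n)
                    (- 1\<^sub>m n)              (0\<^sub>m n n)"

text \<open>Only meaningful if \<open>n \<le> num_edges G\<close>, because of the truncated subtraction.\<close>

definition M_matrix :: "nat \<Rightarrow> nat pair_pre_digraph \<Rightarrow> complex mat" where
  "M_matrix n G =
     (let k = num_edges G - n in diag_block_mat [K_matrix n G, 1\<^sub>m k, - 1\<^sub>m k])"

text \<open>
  \<^term>\<open>jordan_nf A js\<close> says that \<open>A\<close> is similar to the block diagonal matrix whose Jordan blocks
  are, in this order, given by the list \<open>js\<close> of pairs (size, eigenvalue).
\<close>

definition same_jordan_form :: "complex mat \<Rightarrow> complex mat \<Rightarrow> bool" where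
  "same_jordan_form A B \<longleftrightarrow>
     (\<exists>as bs. jordan_nf A as \<and> jordan_nf B bs \<and> mset as = mset bs)"

end

theory Submission
  imports
    Defs
    "Jordan_Normal_Form.Jordan_Normal_Form_Existence"
    "Jordan_Normal_Form.Jordan_Normal_Form_Uniqueness"
begin

text \<open>
  Let \<open>T\<close> and \<open>H\<close> be the \<open>2m \<times> n\<close> matrices recording the tail and the head of every directed edge,
  and let \<open>P\<close> be the permutation matrix that reverses edges. Then \<open>B = H T\<^sup>T - P\<close>, and the block
  matrices \<open>X = [H T]\<close> and \<open>Y\<close>, with row blocks \<open>A T\<^sup>T - H\<^sup>T\<close> and \<open>- T\<^sup>T\<close>, satisfy
  \<open>B X = X K\<close>, \<open>K Y = Y B\<close>, \<open>X Y = B\<^sup>2 - 1\<close> and \<open>Y X = K\<^sup>2 - 1\<close>. Hence \<open>X\<close> and \<open>Y\<close> map the generalised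
  eigenspaces of \<open>K\<close> and \<open>B\<close> for any \<open>a \<noteq> \<plusminus>1\<close> injectively into each other, so the two
  matrices have the same Jordan blocks for these eigenvalues. This is the content of
  \<open>dim_gen_eigenspace_le_if_intertwined\<close>.

  At \<open>s = \<plusminus>1\<close> both matrices turn out to be semisimple when \<open>m \<noteq> n\<close>. An eigenvector of \<open>K\<close> has the
  form \<open>(z, -s z)\<close> with \<open>A z = s D z\<close>. The quadratic form of \<open>D - s A\<close> is a sum of squares
  \<open>|z\<^sub>u - s z\<^sub>v|\<^sup>2\<close> over the edges, so \<open>z\<^sub>u = s z\<^sub>v\<close> along edges, and on a connected graph all
  \<open>z\<^sub>u\<^sup>2\<close> equal one constant \<open>c\<close>. A Jordan chain of length two ending in this eigenvector is solvable
  only if \<open>z \<bullet> D z = 2 (z \<bullet> z)\<close>, that is \<open>2 m c = 2 n c\<close>, which forces \<open>z = 0\<close>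
  (\<open>K_semisimple\<close>). A Jordan chain of \<open>B\<close> is sent by \<open>Y\<close> to one of \<open>K\<close>, and what \<open>Y\<close> kills is
  excluded by applying the involution \<open>P\<close> (\<open>B_semisimple\<close>).

  So at \<open>\<plusminus>1\<close> only two multiplicities remain, and they are determined by two linear equations: the
  size of the matrix and its trace. As \<open>B\<close> and \<open>K\<close> both have trace zero and sizes \<open>2m\<close> and \<open>2n\<close>,
  \<open>B\<close> has exactly \<open>m - n\<close> more blocks than \<open>K\<close> at each of \<open>1\<close> and \<open>-1\<close>; these are the two identity
  blocks of \<open>M\<close> (\<open>same_jordan_form_by_intertwining\<close>).

  Two cycles enter through \<open>m > n\<close>. In the \<open>m\<close>-dimensional space of antisymmetric functions on the
  directed edges, the gradients of vertex potentials form a subspace of dimension \<open>n - 1\<close>, which is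
  orthogonal to the circulations around cycles. Two different cycles carry linearly independent
  circulations because their supports differ, whence \<open>n + 1 \<le> m\<close> (\<open>two_cycles_bound\<close>).
\<close>

section \<open>Intertwined matrices and their generalised eigenspaces\<close>

lemma kernel_dim_le_if_injective:
  fixes A B X :: "'a::field mat"
  assumes A: "A \<in> carrier_mat n n" and B: "B \<in> carrier_mat m m" and X: "X \<in> carrier_mat m n"
    and into: "\<And>v. v \<in> carrier_vec n \<Longrightarrow> A *\<^sub>v v = 0\<^sub>v n \<Longrightarrow> B *\<^sub>v (X *\<^sub>v v) = 0\<^sub>v m"
    and inj: "\<And>v. v \<in> carrier_vec n \<Longrightarrow> A *\<^sub>v v = 0\<^sub>v n \<Longrightarrow> X *\<^sub>v v = 0\<^sub>v m \<Longrightarrow> v = 0\<^sub>v n"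
  shows "kernel_dim A \<le> kernel_dim B"
proof -
  interpret KA: kernel n n A by unfold_locales (rule A)
  interpret KB: kernel m m B by unfold_locales (rule B)
  interpret L: linear_map class_ring KA.VK KB.VK "\<lambda>v. X *\<^sub>v v"
  proof (intro linear_map.intro mod_hom.intro mod_hom_axioms.intro)
    show "(\<lambda>v. X *\<^sub>v v) \<in> module_hom class_ring KA.VK KB.VK"
      using X into mat_kernel[OF A] mat_kernel[OF B]
      by (auto simp: module_hom_def mult_add_distrib_mat_vec mult_mat_vec)
  qed unfold_locales
  have inj_on: "inj_on (\<lambda>v. X *\<^sub>v v) (mat_kernel A)"
  proof (rule inj_onI)
    fix v w assume v: "v \<in> mat_kernel A" and w: "w \<in> mat_kernel A" and eq: "X *\<^sub>v v = X *\<^sub>v w"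
    have c: "v \<in> carrier_vec n" "w \<in> carrier_vec n" using v w mat_kernel[OF A] by auto
    have "X *\<^sub>v (v - w) = 0\<^sub>v m" "A *\<^sub>v (v - w) = 0\<^sub>v n"
      using c v w eq A X mat_kernel[OF A] by (auto simp: mult_minus_distrib_mat_vec)
    then have "v - w = 0\<^sub>v n" using inj c by auto
    then show "v = w" using c by (auto simp: vec_eq_iff)
  qed
  obtain S where S: "finite S" "KA.basis S" using kernel_basis_exists[OF A] by auto
  obtain S' where S': "finite S'" "KB.basis S'" using kernel_basis_exists[OF B] by auto
  have fin: "KB.Ker.fin_dim" using S' unfolding KB.Ker.fin_dim_def KB.Ker.basis_def by auto
  let ?T = "(\<lambda>v. X *\<^sub>v v) ` S"
  have SA: "S \<subseteq> mat_kernel A" and li: "KA.lin_indpt S" using S unfolding KA.Ker.basis_def by auto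
  have TB: "?T \<subseteq> mat_kernel B" using SA into mat_kernel[OF A] mat_kernel[OF B] X by auto
  have "KB.lin_indpt ?T"
  proof (rule KB.Ker.finite_lin_indpt2)
    fix a :: "'a vec \<Rightarrow> 'a" assume a: "KB.lincomb a ?T = 0\<^sub>v m"
    show "\<forall>v\<in>?T. a v = 0"
    proof
      fix v assume v: "v \<in> ?T"
      have "KB.lincomb a ?T = X *\<^sub>v KA.lincomb (a \<circ> (*\<^sub>v) X) S"
        by (rule L.lincomb_linear_image) (use inj_on SA S in auto)
      moreover have in_A: "KA.lincomb (a \<circ> (*\<^sub>v) X) S \<in> mat_kernel A"
        using SA by (intro KA.Ker.lincomb_closed) auto
      ultimately have "KA.lincomb (a \<circ> (*\<^sub>v) X) S = 0\<^sub>v n"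
        using a inj[of "KA.lincomb (a \<circ> (*\<^sub>v) X) S"] mat_kernel[OF A] by auto
      then have "(a \<circ> (*\<^sub>v) X) \<in> S \<rightarrow> {0}"
        using KA.Ker.not_lindepD[OF li S(1) subset_refl, of "a \<circ> (*\<^sub>v) X"] by auto
      then show "a v = 0" using v by auto
    qed
  qed (use S TB in auto)
  then have "card ?T \<le> KB.dim" using KB.Ker.li_le_dim(2)[OF fin TB] by simp
  moreover have "card ?T = card S" using inj_on SA by (meson card_image inj_on_subset)
  moreover have "KA.dim = card S" using KA.Ker.dim_basis S by auto
  ultimately show ?thesis by simp
qed

lemma mult_mat_zero_vec: "A \<in> carrier_mat m n \<Longrightarrow> A *\<^sub>v 0\<^sub>v n = (0\<^sub>v m :: 'a::semiring_0 vec)"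
  by (intro eq_vecI) auto

lemma char_matrix_mult_vec:
  assumes "A \<in> carrier_mat n n" "v \<in> carrier_vec n"
  shows "char_matrix A a *\<^sub>v v = A *\<^sub>v v - a \<cdot>\<^sub>v v"
proof -
  have "char_matrix A a *\<^sub>v v = A *\<^sub>v v + ((-a) \<cdot>\<^sub>m 1\<^sub>m n) *\<^sub>v v"
    using assms unfolding char_matrix_def by (auto intro!: add_mult_distrib_mat_vec)
  also have "((-a) \<cdot>\<^sub>m 1\<^sub>m n) *\<^sub>v v = (-a) \<cdot>\<^sub>v v"
    using assms by (intro eq_vecI) (auto simp: scalar_prod_def if_distrib if_distribR cong: if_cong)
  finally show ?thesis using assms by (auto simp: vec_eq_iff)
qed

lemma char_matrix_mult_vec_eq_0_iff:
  assumes "A \<in> carrier_mat n n" "v \<in> carrier_vec n"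
  shows "char_matrix A a *\<^sub>v v = 0\<^sub>v n \<longleftrightarrow> A *\<^sub>v v = a \<cdot>\<^sub>v v"
  using assms unfolding char_matrix_mult_vec[OF assms] by (auto simp: vec_eq_iff)

lemma char_matrix_intertwine:
  assumes A: "A \<in> carrier_mat n n" and B: "B \<in> carrier_mat m m" and X: "X \<in> carrier_mat m n"
    and BX: "B * X = X * A" and v: "v \<in> carrier_vec n"
  shows "char_matrix B a *\<^sub>v (X *\<^sub>v v) = X *\<^sub>v (char_matrix A a *\<^sub>v v)"
proof -
  have "B *\<^sub>v (X *\<^sub>v v) = X *\<^sub>v (A *\<^sub>v v)"
    using assms by (metis assoc_mult_mat_vec)
  then show ?thesis
    using A B X v by (simp add: char_matrix_mult_vec[OF A v]
        char_matrix_mult_vec[OF B mult_mat_vec_carrier[OF X v]] mult_minus_distrib_mat_vec mult_mat_vec)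
qed

lemma char_matrix_pow_Suc_mult_vec:
  assumes A: "A \<in> carrier_mat n n" and v: "v \<in> carrier_vec n"
  shows "char_matrix A a ^\<^sub>m Suc k *\<^sub>v v = char_matrix A a ^\<^sub>m k *\<^sub>v (char_matrix A a *\<^sub>v v)"
  using assms by (simp add: assoc_mult_mat_vec[of _ n n _ n])

text \<open>
  A vector of the generalised eigenspace that is killed by \<open>X\<close> yields, after applying
  \<open>A - a\<close> often enough, an eigenvector killed by \<open>X\<close>, because the kernel of \<open>X\<close> is invariant
  under \<open>A\<close>. So it suffices to exclude genuine eigenvectors from the kernel of \<open>X\<close>.
\<close>

lemma dim_gen_eigenspace_le_if_intertwined:
  fixes A B X :: "'a::field mat"
  assumes A: "A \<in> carrier_mat n n" and B: "B \<in> carrier_mat m m" and X: "X \<in> carrier_mat m n"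
    and BX: "B * X = X * A"
    and inj: "\<And>v. v \<in> carrier_vec n \<Longrightarrow> A *\<^sub>v v = a \<cdot>\<^sub>v v \<Longrightarrow> X *\<^sub>v v = 0\<^sub>v m \<Longrightarrow> v = 0\<^sub>v n"
  shows "dim_gen_eigenspace A a k \<le> dim_gen_eigenspace B a k"
  unfolding dim_gen_eigenspace_def
proof (rule kernel_dim_le_if_injective)
  show "char_matrix A a ^\<^sub>m k \<in> carrier_mat n n" "char_matrix B a ^\<^sub>m k \<in> carrier_mat m m"
    using A B by auto
  show "X \<in> carrier_mat m n" by fact
  have comm: "char_matrix B a ^\<^sub>m k *\<^sub>v (X *\<^sub>v v) = X *\<^sub>v (char_matrix A a ^\<^sub>m k *\<^sub>v v)"
    if "v \<in> carrier_vec n" for v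
    using that
  proof (induction k arbitrary: v)
    case 0
    have "dim_row (char_matrix A a) = n" "dim_row (char_matrix B a) = m"
      using A B by (auto simp: char_matrix_def)
    then show ?case using 0 X by simp
  next
    case (Suc k)
    have "char_matrix A a *\<^sub>v v \<in> carrier_vec n"
      using mult_mat_vec_carrier[OF char_matrix_closed[OF A] Suc.prems] .
    from Suc.IH[OF this] show ?case
      using A B X Suc.prems
      by (simp only: char_matrix_pow_Suc_mult_vec[OF A Suc.prems]
          char_matrix_pow_Suc_mult_vec[OF B mult_mat_vec_carrier[OF X Suc.prems]]
          char_matrix_intertwine[OF A B X BX Suc.prems])
  qed
  show "char_matrix B a ^\<^sub>m k *\<^sub>v (X *\<^sub>v v) = 0\<^sub>v m"
    if "v \<in> carrier_vec n" "char_matrix A a ^\<^sub>m k *\<^sub>v v = 0\<^sub>v n" for v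
    using comm[OF that(1)] that X by auto
  show "v = 0\<^sub>v n"
    if "v \<in> carrier_vec n" "char_matrix A a ^\<^sub>m k *\<^sub>v v = 0\<^sub>v n" "X *\<^sub>v v = 0\<^sub>v m" for v
    using that
  proof (induction k arbitrary: v)
    case 0
    have "dim_row (char_matrix A a) = n" using A by (auto simp: char_matrix_def)
    then show ?case using 0 by simp
  next
    case (Suc k)
    let ?w = "char_matrix A a *\<^sub>v v"
    have w: "?w \<in> carrier_vec n"
      using mult_mat_vec_carrier[OF char_matrix_closed[OF A] Suc.prems(1)] .
    have "X *\<^sub>v ?w = char_matrix B a *\<^sub>v (X *\<^sub>v v)"
      using char_matrix_intertwine[OF A B X BX Suc.prems(1)] by simp
    also have "\<dots> = 0\<^sub>v m" using Suc.prems mult_mat_zero_vec[OF char_matrix_closed[OF B]] by simp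
    finally have "?w = 0\<^sub>v n"
      using Suc.IH[OF w] Suc.prems by (simp only: char_matrix_pow_Suc_mult_vec[OF A Suc.prems(1)])
    then show ?case
      using inj Suc.prems char_matrix_mult_vec_eq_0_iff[OF A Suc.prems(1)] by auto
  qed
qed

section \<open>Size, trace and semisimple eigenvalues in the Jordan form\<close>

lemma jordan_nf_sum_sizes:
  assumes "A \<in> carrier_mat n n" "jordan_nf A js"
  shows "sum_list (map fst js) = n"
proof -
  obtain P Q where "similar_mat_wit A (jordan_matrix js) P Q"
    using assms unfolding jordan_nf_def similar_mat_def by auto
  from similar_mat_witD2(5)[OF assms(1) this] show ?thesis
    using jordan_matrix_dim(1)[of js] by auto
qed

lemma trace_mult_commute:
  fixes A B :: "'a::comm_semiring_0 mat"
  assumes "A \<in> carrier_mat n m" "B \<in> carrier_mat m n"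
  shows "sum_list (diag_mat (A * B)) = sum_list (diag_mat (B * A))"
proof -
  have "sum_list (diag_mat (A * B)) = (\<Sum>i<n. \<Sum>j<m. A $$ (i, j) * B $$ (j, i))"
    using assms by (auto simp: diag_mat_def scalar_prod_def interv_sum_list_conv_sum_set_nat
        atLeast0LessThan intro!: sum.cong)
  also have "\<dots> = (\<Sum>j<m. \<Sum>i<n. B $$ (j, i) * A $$ (i, j))"
    by (subst sum.swap) (simp add: mult.commute)
  also have "\<dots> = sum_list (diag_mat (B * A))"
    using assms by (auto simp: diag_mat_def scalar_prod_def interv_sum_list_conv_sum_set_nat
        atLeast0LessThan intro!: sum.cong)
  finally show ?thesis .
qed

lemma jordan_nf_trace:
  fixes A :: "'a::comm_ring_1 mat"
  assumes A: "A \<in> carrier_mat n n" and js: "jordan_nf A js"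
  shows "sum_list (diag_mat A) = (\<Sum>(k, a)\<leftarrow>js. of_nat k * a)"
proof -
  obtain P Q where wit: "similar_mat_wit A (jordan_matrix js) P Q"
    using js unfolding jordan_nf_def similar_mat_def by auto
  note w = similar_mat_witD2[OF A wit]
  have "sum_list (diag_mat A) = sum_list (diag_mat (P * (jordan_matrix js * Q)))"
    using w by (simp add: assoc_mult_mat[of _ n n _ n _ n])
  also have "\<dots> = sum_list (diag_mat (jordan_matrix js * Q * P))"
    using w by (intro trace_mult_commute) auto
  also have "jordan_matrix js * Q * P = jordan_matrix js"
    using w by (simp add: assoc_mult_mat[of _ n n _ n _ n] right_mult_one_mat[of _ n n] del: jordan_matrix_carrier)
  also have "sum_list (diag_mat (jordan_matrix js)) = (\<Sum>(k, a)\<leftarrow>js. of_nat k * a)"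
  proof (induction js)
    case Nil
    then show ?case by (simp add: jordan_matrix_def diag_mat_def)
  next
    case (Cons j js)
    obtain k a where j: "j = (k, a)" by force
    have "diag_mat (jordan_block k a) = replicate k a"
      by (rule nth_equalityI) (auto simp: diag_mat_def)
    then show ?case
      using Cons unfolding j jordan_matrix_Cons
      by (subst diag_four_block_mat[of _ k _ "sum_list (map fst js)"])
        (auto simp: sum_list_replicate)
  qed
  finally show ?thesis .
qed

text \<open>
  The dimension of the kernel of \<open>(A - a)\<^sup>k\<close> is the sum of \<open>min k l\<close> over the sizes \<open>l\<close> of the blocks
  with eigenvalue \<open>a\<close>. It does not grow from \<open>k = 1\<close> to \<open>k = 2\<close>, which leaves no room for a block
  of size two or more.
\<close>

lemma semisimple_jordan_block_size:
  fixes A :: "complex mat"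
  assumes A: "A \<in> carrier_mat n n" and js: "jordan_nf A js"
    and semisimple: "\<And>v. v \<in> carrier_vec n \<Longrightarrow>
      char_matrix A a *\<^sub>v (char_matrix A a *\<^sub>v v) = 0\<^sub>v n \<Longrightarrow> char_matrix A a *\<^sub>v v = 0\<^sub>v n"
    and mem: "(k, a) \<in> set js"
  shows "k = 1"
proof -
  let ?C = "char_matrix A a"
  have C: "?C \<in> carrier_mat n n" using A by simp
  have "dim_gen_eigenspace A a 2 \<le> dim_gen_eigenspace A a 1"
    unfolding dim_gen_eigenspace_def
  proof (rule kernel_dim_le_if_injective[of _ n _ n "1\<^sub>m n"])
    fix v assume v: "v \<in> carrier_vec n" and "?C ^\<^sub>m 2 *\<^sub>v v = 0\<^sub>v n"
    then have "?C *\<^sub>v (?C *\<^sub>v v) = 0\<^sub>v n"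
      using C by (simp add: numeral_2_eq_2 assoc_mult_mat_vec[of _ n n _ n] A)
    then show "?C ^\<^sub>m 1 *\<^sub>v (1\<^sub>m n *\<^sub>v v) = 0\<^sub>v n" using semisimple v A by simp
  qed (use C in auto)
  then have le: "(\<Sum>k\<leftarrow>map fst [(n, e)\<leftarrow>js. e = a]. min 2 k) \<le> (\<Sum>k\<leftarrow>map fst [(n, e)\<leftarrow>js. e = a]. min 1 k)"
    unfolding dim_gen_eigenspace[OF js] .
  have mono: "(\<Sum>k\<leftarrow>ks. min 1 k) \<le> (\<Sum>k\<leftarrow>ks. min 2 k)" for ks :: "nat list"
    by (rule sum_list_mono) auto
  have small: "k \<le> 1" if "(\<Sum>k\<leftarrow>ks. min 2 k) \<le> (\<Sum>k\<leftarrow>ks. min 1 k)" "k \<in> set ks" for k and ks :: "nat list"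
    using that
  proof (induction ks)
    case (Cons x ks)
    show ?case using Cons mono[of ks] by auto
  qed simp
  have "k \<in> set (map fst [(n, e)\<leftarrow>js. e = a])" using mem by force
  from small[OF le this] have "k \<le> 1" .
  moreover have "k \<noteq> 0" using js mem unfolding jordan_nf_def by force
  ultimately show ?thesis by simp
qed


lemma jordan_nf_smult_one:
  "jordan_nf (a \<cdot>\<^sub>m 1\<^sub>m k) (replicate k (1, a :: 'a::field))"
proof -
  have "jordan_matrix (replicate k (1, a)) = a \<cdot>\<^sub>m 1\<^sub>m k"
  proof (induction k)
    case 0
    then show ?case by (intro eq_matI) (auto simp: jordan_matrix_def)
  next
    case (Suc k)
    have "sum_list (map fst (replicate k (1::nat, a))) = k" by (simp add: sum_list_replicate)
    then show ?case using Suc by (intro eq_matI) (auto simp: jordan_matrix_Cons)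
  qed
  then show ?thesis
    unfolding jordan_nf_def by (auto intro: similar_mat_refl[of _ k])
qed

lemma count_mset_eq_length: "count (mset xs) x = length (filter ((=) x) xs)"
  by (induction xs) auto

lemma replicate_mset_add: "replicate_mset (k + l) x = replicate_mset k x + replicate_mset l x"
  by (rule multiset_eqI) simp

lemma mset_split_off_pm_one:
  fixes js :: "(nat \<times> complex) list"
  assumes "\<And>k a. (k, a) \<in> set js \<Longrightarrow> a = 1 \<or> a = -1 \<Longrightarrow> k = 1"
  shows "mset js = filter_mset (\<lambda>(k, a). a \<noteq> 1 \<and> a \<noteq> -1) (mset js)
    + replicate_mset (count (mset js) (1, 1)) (1, 1) + replicate_mset (count (mset js) (1, -1)) (1, -1)"
proof (rule multiset_eqI)
  fix x :: "nat \<times> complex"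
  obtain k a where x: "x = (k, a)" by force
  show "count (mset js) x = count (filter_mset (\<lambda>(k, a). a \<noteq> 1 \<and> a \<noteq> -1) (mset js)
    + replicate_mset (count (mset js) (1, 1)) (1, 1) + replicate_mset (count (mset js) (1, -1)) (1, -1)) x"
  proof (cases "k \<noteq> 1 \<and> (a = 1 \<or> a = -1)")
    case True
    then have "count (mset js) x = 0"
      using assms unfolding x by (force simp: count_eq_zero_iff)
    then show ?thesis using True by (auto simp: x)
  qed (auto simp: x)
qed

lemma jordan_block_sums:
  fixes js :: "(nat \<times> complex) list" and b c :: nat
  assumes "mset js = R + replicate_mset b (1, 1) + replicate_mset c (1, -1)"
  shows "sum_list (map fst js) = (\<Sum>x\<in>#R. fst x) + b + c"
    and "(\<Sum>(k, a)\<leftarrow>js. of_nat k * a) = (\<Sum>(k, a)\<in>#R. of_nat k * a) + of_nat b - of_nat c"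
proof -
  have "sum_list (map fst js) = (\<Sum>x\<in>#mset js. fst x)"
    by (metis mset_map sum_mset_sum_list)
  then show "sum_list (map fst js) = (\<Sum>x\<in>#R. fst x) + b + c"
    unfolding assms by simp
  have "(\<Sum>(k, a)\<leftarrow>js. of_nat k * a) = (\<Sum>(k, a)\<in>#mset js. of_nat k * a)"
    by (metis mset_map sum_mset_sum_list)
  then show "(\<Sum>(k, a)\<leftarrow>js. of_nat k * a) = (\<Sum>(k, a)\<in>#R. of_nat k * a) + of_nat b - of_nat c"
    unfolding assms by simp
qed

text \<open>
  A Sylvester-type comparison of two matrices of different sizes. For ordinary products \<open>X Y\<close> and
  \<open>Y X\<close> the nonzero part of the Jordan structure agrees; here the products are \<open>B\<^sup>2 - 1\<close> and
  \<open>A\<^sup>2 - 1\<close>, so the comparison fails at the zeros \<open>\<plusminus>1\<close> of \<open>a\<^sup>2 - 1\<close> only. Semisimplicity there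
  reduces the blocks to two multiplicities, which size and trace determine.
\<close>

theorem same_jordan_form_by_intertwining:
  fixes A B X Y :: "complex mat"
  assumes A: "A \<in> carrier_mat n n" and B: "B \<in> carrier_mat (n + 2 * d) (n + 2 * d)"
    and X: "X \<in> carrier_mat (n + 2 * d) n" and Y: "Y \<in> carrier_mat n (n + 2 * d)"
    and BX: "B * X = X * A" and AY: "A * Y = Y * B"
    and XY: "X * Y = B * B - 1\<^sub>m (n + 2 * d)" and YX: "Y * X = A * A - 1\<^sub>m n"
    and semisimple_A: "\<And>s v. s = 1 \<or> s = -1 \<Longrightarrow> v \<in> carrier_vec n \<Longrightarrow>
      char_matrix A s *\<^sub>v (char_matrix A s *\<^sub>v v) = 0\<^sub>v n \<Longrightarrow> char_matrix A s *\<^sub>v v = 0\<^sub>v n"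
    and semisimple_B: "\<And>s v. s = 1 \<or> s = -1 \<Longrightarrow> v \<in> carrier_vec (n + 2 * d) \<Longrightarrow>
      char_matrix B s *\<^sub>v (char_matrix B s *\<^sub>v v) = 0\<^sub>v (n + 2 * d) \<Longrightarrow>
      char_matrix B s *\<^sub>v v = 0\<^sub>v (n + 2 * d)"
    and trace: "sum_list (diag_mat A) = sum_list (diag_mat B)"
  shows "same_jordan_form B (diag_block_mat [A, 1\<^sub>m d, - 1\<^sub>m d])"
proof -
  have ex: "\<exists>js. jordan_nf C js" if "C \<in> carrier_mat l l" for C :: "complex mat" and l
    using char_poly_factorized[OF that] jordan_nf_exists[OF that] by blast
  obtain as where as: "jordan_nf A as" using ex[OF A] by blast
  obtain bs where bs: "jordan_nf B bs" using ex[OF B] by blast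
  let ?cs = "as @ replicate d (1, 1) @ replicate d (1, -1)"
  have "- 1\<^sub>m d = (-1::complex) \<cdot>\<^sub>m 1\<^sub>m d" "1\<^sub>m d = (1::complex) \<cdot>\<^sub>m 1\<^sub>m d"
    by auto
  then have "jordan_nf (- 1\<^sub>m d) (replicate d (1, -1 :: complex))" "jordan_nf (1\<^sub>m d) (replicate d (1, 1 :: complex))"
    using jordan_nf_smult_one by metis+
  then have cs: "jordan_nf (diag_block_mat [A, 1\<^sub>m d, - 1\<^sub>m d]) ?cs"
    using jordan_nf_diag_block_mat[of "[(A, as), (1\<^sub>m d, replicate d (1, 1)), (- 1\<^sub>m d, replicate d (1, -1))]"] as
    by auto
  \<comment> \<open>If \<open>C v = a v\<close>, then \<open>Z W v = (a\<^sup>2 - 1) v\<close>, and the factor \<open>a\<^sup>2 - 1\<close> is invertible.\<close>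
  have kernel_trivial: "v = 0\<^sub>v l"
    if C: "C \<in> carrier_mat l l" and Z: "Z \<in> carrier_mat l l'" and W: "W \<in> carrier_mat l' l"
      and ZW: "Z * W = C * C - 1\<^sub>m l" and v: "v \<in> carrier_vec l"
      and Cv: "C *\<^sub>v v = a \<cdot>\<^sub>v v" and Wv: "W *\<^sub>v v = 0\<^sub>v l'" and a: "a \<noteq> 1" "a \<noteq> -1"
    for C Z W :: "complex mat" and l l' v a
  proof -
    have "(C * C - 1\<^sub>m l) *\<^sub>v v = 0\<^sub>v l"
      using Z W Wv v unfolding ZW[symmetric] by (auto simp: assoc_mult_mat_vec[of _ l l' _ l])
    moreover have "(C * C - 1\<^sub>m l) *\<^sub>v v = C *\<^sub>v (C *\<^sub>v v) - v"
      using C v by (simp add: minus_mult_distrib_mat_vec[of _ l l] assoc_mult_mat_vec[of _ l l _ l])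
    moreover have "C *\<^sub>v (C *\<^sub>v v) = (a * a) \<cdot>\<^sub>v v"
      using C v Cv by (simp add: mult_mat_vec smult_smult_assoc)
    ultimately have "(a * a) \<cdot>\<^sub>v v - v = 0\<^sub>v l" by simp
    then have "((a * a) \<cdot>\<^sub>v v - v) $ i = 0" if "i < l" for i
      using that by simp
    then have "(a * a - 1) * v $ i = 0" if "i < l" for i
      using v that by (simp add: algebra_simps)
    moreover have "a * a - 1 \<noteq> 0" using a by (simp add: square_eq_1_iff)
    ultimately show ?thesis using v by (auto simp: vec_eq_iff)
  qed
  have dims: "dim_gen_eigenspace A a k = dim_gen_eigenspace B a k" if a: "a \<noteq> 1" "a \<noteq> -1" for a k
  proof (rule antisym)
    show "dim_gen_eigenspace A a k \<le> dim_gen_eigenspace B a k"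
      using kernel_trivial[OF A Y X YX] a by (intro dim_gen_eigenspace_le_if_intertwined[OF A B X BX]) blast
    show "dim_gen_eigenspace B a k \<le> dim_gen_eigenspace A a k"
      using kernel_trivial[OF B X Y XY] a by (intro dim_gen_eigenspace_le_if_intertwined[OF B A Y AY]) blast
  qed
  have away: "filter_mset (\<lambda>(k, a). a \<noteq> 1 \<and> a \<noteq> -1) (mset as) = filter_mset (\<lambda>(k, a). a \<noteq> 1 \<and> a \<noteq> -1) (mset bs)"
    (is "?R as = ?R bs")
  proof (rule multiset_eqI)
    fix x :: "nat \<times> complex"
    obtain k a where x: "x = (k, a)" by force
    show "count (?R as) x = count (?R bs) x"
    proof (cases "k = 0 \<or> a = 1 \<or> a = -1")
      case True
      moreover have "(0, a) \<notin> set as" "(0, a) \<notin> set bs"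
        using as bs unfolding jordan_nf_def by force+
      then have "count (mset as) (0, a) = count (mset bs) (0, a)"
        by (metis not_in_iff set_mset_mset)
      ultimately show ?thesis by (auto simp: x)
    next
      case False
      then have "compute_nr_of_jordan_blocks A a k = compute_nr_of_jordan_blocks B a k"
        unfolding compute_nr_of_jordan_blocks_def using dims by simp
      then show ?thesis
        using False compute_nr_of_jordan_blocks[OF as, of k a] compute_nr_of_jordan_blocks[OF bs, of k a]
        by (simp add: x count_mset_eq_length)
    qed
  qed
  have size_as: "k = 1" if "(k, a) \<in> set as" "a = 1 \<or> a = -1" for k a
    using semisimple_jordan_block_size[OF A as semisimple_A] that by blast
  have split_as: "mset as = ?R bs
    + replicate_mset (count (mset as) (1, 1)) (1, 1) + replicate_mset (count (mset as) (1, -1)) (1, -1)"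
    using mset_split_off_pm_one[of as] size_as unfolding away by blast
  have size_bs: "k = 1" if "(k, a) \<in> set bs" "a = 1 \<or> a = -1" for k a
    using semisimple_jordan_block_size[OF B bs semisimple_B] that by blast
  have split_bs: "mset bs = ?R bs
    + replicate_mset (count (mset bs) (1, 1)) (1, 1) + replicate_mset (count (mset bs) (1, -1)) (1, -1)"
    using mset_split_off_pm_one[of bs] size_bs by blast
  define p p' q q' where "p = count (mset as) (1, 1)" "p' = count (mset as) (1, -1)"
    "q = count (mset bs) (1, 1)" "q' = count (mset bs) (1, -1)"
  note sums_as = jordan_block_sums[OF split_as, folded p_p'_q_q'_def]
  note sums_bs = jordan_block_sums[OF split_bs, folded p_p'_q_q'_def]
  \<comment> \<open>The sizes give \<open>q + q'\<close>, the traces give \<open>q - q'\<close>.\<close>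
  have "q + q' = p + p' + 2 * d"
    using sums_as(1) sums_bs(1) jordan_nf_sum_sizes[OF A as] jordan_nf_sum_sizes[OF B bs] by linarith
  moreover have "of_nat q - of_nat q' = (of_nat p - of_nat p' :: complex)"
    using sums_as(2) sums_bs(2) jordan_nf_trace[OF A as] jordan_nf_trace[OF B bs] trace
    by (metis (no_types, lifting) add_diff_eq add_left_cancel)
  then have "of_nat (q + p') = (of_nat (p + q') :: complex)"
    by (simp add: algebra_simps)
  then have "q + p' = p + q'" by (simp only: of_nat_eq_iff)
  ultimately have qp: "q = d + p" "q' = d + p'" by auto
  have "mset ?cs = ?R bs + replicate_mset (d + p) (1, 1) + replicate_mset (d + p') (1, -1)"
    using split_as unfolding p_p'_q_q'_def[symmetric] by (simp add: replicate_mset_add)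
  also have "\<dots> = mset bs"
    using split_bs unfolding p_p'_q_q'_def[symmetric] qp by simp
  finally have "mset ?cs = mset bs" .
  then show ?thesis unfolding same_jordan_form_def using bs cs by metis
qed

section \<open>Row and column blocks\<close>

text \<open>
  Juxtaposition and stacking are cast as \<open>four_block_mat\<close> with two empty blocks, so that all
  product rules below are instances of the multiplication rule for two-by-two block matrices.
\<close>

definition hcat :: "'a::zero mat \<Rightarrow> 'a mat \<Rightarrow> 'a mat" where
  "hcat L R = four_block_mat L R (0\<^sub>m 0 (dim_col L)) (0\<^sub>m 0 (dim_col R))"

definition vcat :: "'a::zero mat \<Rightarrow> 'a mat \<Rightarrow> 'a mat" where
  "vcat U V = four_block_mat U (0\<^sub>m (dim_row U) 0) V (0\<^sub>m (dim_row V) 0)"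

lemma four_block_mat_empty:
  "A \<in> carrier_mat k l \<Longrightarrow> four_block_mat A (0\<^sub>m k 0) (0\<^sub>m 0 l) (0\<^sub>m 0 0) = A"
  by (intro eq_matI) auto

lemma hcat_carrier:
  "L \<in> carrier_mat k l \<Longrightarrow> R \<in> carrier_mat k r \<Longrightarrow> hcat L R \<in> carrier_mat k (l + r)"
  unfolding hcat_def carrier_mat_def by auto

lemma vcat_carrier:
  "U \<in> carrier_mat u k \<Longrightarrow> V \<in> carrier_mat v k \<Longrightarrow> vcat U V \<in> carrier_mat (u + v) k"
  unfolding vcat_def carrier_mat_def by auto

lemma mult_hcat:
  fixes Z :: "'a::comm_ring_1 mat"
  assumes "Z \<in> carrier_mat j k" "L \<in> carrier_mat k l" "R \<in> carrier_mat k r"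
  shows "Z * hcat L R = hcat (Z * L) (Z * R)"
  using assms mult_four_block_mat[of Z j k "0\<^sub>m j 0" 0 "0\<^sub>m 0 k" 0 "0\<^sub>m 0 0" L l R r "0\<^sub>m 0 l" "0\<^sub>m 0 r"]
  unfolding hcat_def by (simp add: four_block_mat_empty)

lemma vcat_mult:
  fixes Z :: "'a::comm_ring_1 mat"
  assumes "Z \<in> carrier_mat k j" "U \<in> carrier_mat u k" "V \<in> carrier_mat v k"
  shows "vcat U V * Z = vcat (U * Z) (V * Z)"
  using assms mult_four_block_mat[of U u k "0\<^sub>m u 0" 0 V v "0\<^sub>m v 0" Z j "0\<^sub>m k 0" 0 "0\<^sub>m 0 j" "0\<^sub>m 0 0"]
  unfolding vcat_def by (simp add: four_block_mat_empty)

lemma vcat_mult_vec: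
  fixes U :: "'a::comm_ring_1 mat"
  assumes "U \<in> carrier_mat u k" "V \<in> carrier_mat v k" "x \<in> carrier_vec k"
  shows "vcat U V *\<^sub>v x = (U *\<^sub>v x) @\<^sub>v (V *\<^sub>v x)"
  using assms by (intro eq_vecI) (auto simp: vcat_def scalar_prod_def intro!: sum.cong)

lemma hcat_mult_four_block:
  fixes L :: "'a::comm_ring_1 mat"
  assumes "L \<in> carrier_mat k l" "R \<in> carrier_mat k r" "A \<in> carrier_mat l a" "B \<in> carrier_mat l b"
    "C \<in> carrier_mat r a" "D \<in> carrier_mat r b"
  shows "hcat L R * four_block_mat A B C D = hcat (L * A + R * C) (L * B + R * D)"
  using assms mult_four_block_mat[of L k l R r "0\<^sub>m 0 l" 0 "0\<^sub>m 0 r" A a B b C D]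
  unfolding hcat_def by simp

lemma four_block_mult_vcat:
  fixes U :: "'a::comm_ring_1 mat"
  assumes "U \<in> carrier_mat u k" "V \<in> carrier_mat v k" "A \<in> carrier_mat a u" "B \<in> carrier_mat a v"
    "C \<in> carrier_mat c u" "D \<in> carrier_mat c v"
  shows "four_block_mat A B C D * vcat U V = vcat (A * U + B * V) (C * U + D * V)"
  using assms mult_four_block_mat[of A a u B v C c D U k "0\<^sub>m u 0" 0 V "0\<^sub>m v 0"]
  unfolding vcat_def by simp

lemma hcat_mult_vcat:
  fixes L :: "'a::comm_ring_1 mat"
  assumes "L \<in> carrier_mat k l" "R \<in> carrier_mat k r" "U \<in> carrier_mat l j" "V \<in> carrier_mat r j"
  shows "hcat L R * vcat U V = L * U + R * V"
  using assms mult_four_block_mat[of L k l R r "0\<^sub>m 0 l" 0 "0\<^sub>m 0 r" U j "0\<^sub>m l 0" 0 V "0\<^sub>m r 0"]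
  unfolding hcat_def vcat_def by (simp add: four_block_mat_empty[of _ k j])

lemma vcat_mult_hcat:
  fixes L :: "'a::comm_ring_1 mat"
  assumes "U \<in> carrier_mat u k" "V \<in> carrier_mat v k" "L \<in> carrier_mat k l" "R \<in> carrier_mat k r"
  shows "vcat U V * hcat L R = four_block_mat (U * L) (U * R) (V * L) (V * R)"
  using assms mult_four_block_mat[of U u k "0\<^sub>m u 0" 0 V v "0\<^sub>m v 0" L l R r "0\<^sub>m 0 l" "0\<^sub>m 0 r"]
  unfolding hcat_def vcat_def by simp


section \<open>Incidence matrices of a graph\<close>

locale listed_graph = pair_graph G for G :: "nat pair_pre_digraph" +
  fixes n :: nat and es :: "(nat \<times> nat) list"
  assumes verts_eq: "pverts G = {1..n}" and distinct_es: "distinct es" and set_es: "set es = parcs G"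
begin

abbreviation N :: nat where "N \<equiv> length es"

definition T :: "complex mat" where
  "T = mat N n (\<lambda>(p, i). of_bool (fst (es ! p) = Suc i))"

definition H :: "complex mat" where
  "H = mat N n (\<lambda>(p, i). of_bool (snd (es ! p) = Suc i))"

definition P :: "complex mat" where
  "P = mat N N (\<lambda>(p, q). of_bool (es ! q = prod.swap (es ! p)))"

abbreviation A :: "complex mat" where "A \<equiv> adjacency_matrix n G"
abbreviation D :: "complex mat" where "D \<equiv> degree_matrix n G"
abbreviation B :: "complex mat" where "B \<equiv> nonbacktracking_matrix es"
abbreviation K :: "complex mat" where "K \<equiv> K_matrix n G"

lemma carriers [simp]:
  "T \<in> carrier_mat N n" "H \<in> carrier_mat N n" "P \<in> carrier_mat N N"
  "T\<^sup>T \<in> carrier_mat n N" "H\<^sup>T \<in> carrier_mat n N"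
  "A \<in> carrier_mat n n" "D \<in> carrier_mat n n" "B \<in> carrier_mat N N" "K \<in> carrier_mat (n + n) (n + n)"
  by (auto simp: T_def H_def P_def adjacency_matrix_def degree_matrix_def nonbacktracking_matrix_def
      K_matrix_def)

lemma dims [simp]:
  "dim_row T = N" "dim_col T = n" "dim_row H = N" "dim_col H = n" "dim_row P = N" "dim_col P = N"
  "dim_row A = n" "dim_col A = n" "dim_row D = n" "dim_col D = n" "dim_row B = N" "dim_col B = N"
  by (auto simp: T_def H_def P_def adjacency_matrix_def degree_matrix_def nonbacktracking_matrix_def)

lemma product_carriers [simp]:
  "A * T\<^sup>T \<in> carrier_mat n N" "H * T\<^sup>T \<in> carrier_mat N N" "A * T\<^sup>T - H\<^sup>T \<in> carrier_mat n N"
  by (auto intro!: mult_carrier_mat minus_carrier_mat)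

lemma sum_arcs: "(\<Sum>p<N. g (es ! p)) = (\<Sum>e\<in>parcs G. g e)" for g :: "nat \<times> nat \<Rightarrow> 'b::comm_monoid_add"
  using sum.reindex_bij_betw[OF bij_betw_nth[OF distinct_es refl refl], of g] set_es by simp

lemma nth_es_arc: "p < N \<Longrightarrow> es ! p \<in> parcs G"
  using set_es nth_mem by blast

lemma swap_arc_iff [simp]: "prod.swap e \<in> parcs G \<longleftrightarrow> e \<in> parcs G"
  by (cases e) (auto intro: arcs_symmetric)

lemma nth_es_swap_iff: "p < N \<Longrightarrow> q < N \<Longrightarrow> es ! p = es ! q \<longleftrightarrow> p = q"
  using distinct_es nth_eq_iff_index_eq by blast

lemma P_mult_entry:
  assumes "p < N" "j < k" "M \<in> carrier_mat N k" and M: "\<And>q. q < N \<Longrightarrow> M $$ (q, j) = g (es ! q)"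
  shows "(P * M) $$ (p, j) = g (prod.swap (es ! p))"
proof -
  have "(P * M) $$ (p, j) = (\<Sum>q<N. of_bool (es ! q = prod.swap (es ! p)) * g (es ! q))"
    using assms by (auto simp: P_def scalar_prod_def atLeast0LessThan intro!: sum.cong)
  also have "\<dots> = (\<Sum>e\<in>parcs G. of_bool (e = prod.swap (es ! p)) * g e)"
    by (rule sum_arcs)
  also have "\<dots> = (\<Sum>e\<in>parcs G. if e = prod.swap (es ! p) then g e else 0)"
    by (intro sum.cong) auto
  also have "\<dots> = g (prod.swap (es ! p))"
    using assms(1) pair_finite_arcs by (simp add: sum.delta nth_es_arc)
  finally show ?thesis .
qed

lemma P_T: "P * T = H"
proof (intro eq_matI)
  fix p j assume "p < dim_row H" "j < dim_col H"
  then have "p < N" "j < n" by (auto simp: H_def)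
  then show "(P * T) $$ (p, j) = H $$ (p, j)"
    by (subst P_mult_entry[where g = "\<lambda>e. of_bool (fst e = Suc j)"]) (auto simp: T_def H_def)
qed (auto simp: P_def T_def H_def)

lemma P_H: "P * H = T"
proof (intro eq_matI)
  fix p j assume "p < dim_row T" "j < dim_col T"
  then have "p < N" "j < n" by (auto simp: T_def)
  then show "(P * H) $$ (p, j) = T $$ (p, j)"
    by (subst P_mult_entry[where g = "\<lambda>e. of_bool (snd e = Suc j)"]) (auto simp: T_def H_def)
qed (auto simp: P_def T_def H_def)

lemma P_P: "P * P = 1\<^sub>m N"
proof (intro eq_matI)
  fix p j assume "p < dim_row (1\<^sub>m N :: complex mat)" "j < dim_col (1\<^sub>m N :: complex mat)"
  then have "p < N" "j < N" by auto
  then show "(P * P) $$ (p, j) = 1\<^sub>m N $$ (p, j)"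
    by (subst P_mult_entry[where g = "\<lambda>e. of_bool (es ! j = prod.swap e)"])
      (auto simp: P_def nth_es_swap_iff)
qed (auto simp: P_def)

lemma P_transpose: "P\<^sup>T = P"
  by (intro eq_matI) (auto simp: P_def of_bool_def)

lemma T_transpose_P: "T\<^sup>T * P = H\<^sup>T"
  using transpose_mult[of P N N T n] P_T P_transpose by simp

lemma H_transpose_P: "H\<^sup>T * P = T\<^sup>T"
  using transpose_mult[of P N N H n] P_H P_transpose by simp

lemma T_transpose_H: "T\<^sup>T * H = A"
proof (intro eq_matI)
  fix i j assume "i < dim_row A" "j < dim_col A"
  then have ij: "i < n" "j < n" by (auto simp: adjacency_matrix_def)
  then have "(T\<^sup>T * H) $$ (i, j) = (\<Sum>p<N. of_bool (fst (es ! p) = Suc i) * of_bool (snd (es ! p) = Suc j))"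
    by (auto simp: T_def H_def scalar_prod_def atLeast0LessThan intro!: sum.cong)
  also have "\<dots> = (\<Sum>e\<in>parcs G. of_bool (fst e = Suc i) * of_bool (snd e = Suc j))"
    by (rule sum_arcs)
  also have "\<dots> = (\<Sum>e\<in>parcs G. if e = (Suc i, Suc j) then 1 else 0)"
    by (intro sum.cong) auto
  also have "\<dots> = A $$ (i, j)"
    using ij pair_finite_arcs by (simp add: adjacency_matrix_def)
  finally show "(T\<^sup>T * H) $$ (i, j) = A $$ (i, j)" .
qed (auto simp: T_def H_def adjacency_matrix_def)

lemma T_transpose_T: "T\<^sup>T * T = D"
proof (intro eq_matI)
  fix i j assume "i < dim_row D" "j < dim_col D"
  then have ij: "i < n" "j < n" by (auto simp: degree_matrix_def)
  then have "(T\<^sup>T * T) $$ (i, j) = (\<Sum>p<N. of_bool (fst (es ! p) = Suc i) * of_bool (fst (es ! p) = Suc j))"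
    by (auto simp: T_def scalar_prod_def atLeast0LessThan intro!: sum.cong)
  also have "\<dots> = (\<Sum>e\<in>parcs G. of_bool (fst e = Suc i) * of_bool (fst e = Suc j))"
    by (rule sum_arcs)
  also have "\<dots> = (\<Sum>e\<in>parcs G. if fst e = Suc i \<and> i = j then 1 else 0)"
    by (intro sum.cong) auto
  also have "\<dots> = of_bool (i = j) * of_nat (card {e \<in> parcs G. fst e = Suc i})"
    using pair_finite_arcs by (auto simp: sum.inter_filter[symmetric])
  also have "\<dots> = D $$ (i, j)"
    using ij by (simp add: degree_matrix_def out_degree_def out_arcs_def)
  finally show "(T\<^sup>T * T) $$ (i, j) = D $$ (i, j)" .
qed (auto simp: T_def degree_matrix_def)

lemma A_transpose: "A\<^sup>T = A"
  by (intro eq_matI) (auto simp: adjacency_matrix_def intro: arcs_symmetric)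

lemma H_transpose_T: "H\<^sup>T * T = A"
  using transpose_mult[of "T\<^sup>T" n N H n] T_transpose_H A_transpose by simp

lemma H_transpose_H: "H\<^sup>T * H = D"
  using assoc_mult_mat[of "T\<^sup>T" n N P N H n] T_transpose_P P_H T_transpose_T by simp

lemma B_eq: "B = H * T\<^sup>T - P"
proof (intro eq_matI)
  fix p q assume "p < dim_row (H * T\<^sup>T - P)" "q < dim_col (H * T\<^sup>T - P)"
  then have pq: "p < N" "q < N" by (auto simp: P_def)
  obtain i j where p: "es ! p = (i, j)" by force
  obtain k l where q: "es ! q = (k, l)" by force
  have "j \<in> {1..n}" using nth_es_arc[OF pq(1)] in_arcsD2 verts_eq p by auto
  then have j: "j = Suc (j - 1)" "j - 1 < n" by auto
  have "(H * T\<^sup>T) $$ (p, q) = (\<Sum>v<n. of_bool (j = Suc v) * of_bool (k = Suc v))"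
    using pq p q by (auto simp: H_def T_def scalar_prod_def atLeast0LessThan intro!: sum.cong)
  also have "\<dots> = (\<Sum>v<n. if v = j - 1 then of_bool (k = j) else 0)"
    using j by (intro sum.cong) auto
  also have "\<dots> = of_bool (k = j)" using j by simp
  finally show "B $$ (p, q) = (H * T\<^sup>T - P) $$ (p, q)"
    using pq p q by (auto simp: P_def nonbacktracking_matrix_def)
qed (auto simp: P_def nonbacktracking_matrix_def)

lemma B_H: "B * H = H * A - T"
proof -
  have "B * H = H * T\<^sup>T * H - P * H"
    unfolding B_eq by (rule minus_mult_distrib_mat[of _ N N]) auto
  then show ?thesis by (simp add: P_H assoc_mult_mat[of _ N n _ N _ n] T_transpose_H)
qed

lemma B_T: "B * T = H * D - H"
proof -
  have "B * T = H * T\<^sup>T * T - P * T"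
    unfolding B_eq by (rule minus_mult_distrib_mat[of _ N N]) auto
  then show ?thesis by (simp add: P_T assoc_mult_mat[of _ N n _ N _ n] T_transpose_T)
qed

lemma T_transpose_B: "T\<^sup>T * B = A * T\<^sup>T - H\<^sup>T"
proof -
  have "T\<^sup>T * B = T\<^sup>T * (H * T\<^sup>T) - T\<^sup>T * P"
    unfolding B_eq by (rule mult_minus_distrib_mat[of _ _ N _ N]) auto
  then show ?thesis
    by (simp add: T_transpose_P assoc_mult_mat[of _ n N _ n _ N, symmetric] T_transpose_H)
qed

lemma H_transpose_B: "H\<^sup>T * B = D * T\<^sup>T - T\<^sup>T"
proof -
  have "H\<^sup>T * B = H\<^sup>T * (H * T\<^sup>T) - H\<^sup>T * P"
    unfolding B_eq by (rule mult_minus_distrib_mat[of _ _ N _ N]) auto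
  then show ?thesis
    by (simp add: H_transpose_P assoc_mult_mat[of _ n N _ n _ N, symmetric] H_transpose_H)
qed

lemma P_B: "P * B = T * T\<^sup>T - 1\<^sub>m N"
proof -
  have "P * B = P * (H * T\<^sup>T) - P * P"
    unfolding B_eq by (rule mult_minus_distrib_mat[of _ _ N _ N]) auto
  then show ?thesis
    by (simp add: P_P assoc_mult_mat[of _ N N _ n _ N, symmetric] P_H)
qed

text \<open>
  \<open>X\<close> extends a pair of vertex functions to the directed edges and \<open>Y\<close> collects an edge function at
  the vertices. Since \<open>B\<close> differs from \<open>- P\<close> only by a map into the span of the columns of \<open>H\<close>,
  \<open>B\<close> squares to the identity modulo the image of \<open>X\<close>; \<open>Y\<close> is the matrix that writes
  \<open>B\<^sup>2 - 1\<close> in terms of the columns of \<open>X\<close>.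
\<close>

definition X :: "complex mat" where "X = hcat H T"

definition Y :: "complex mat" where "Y = vcat (A * T\<^sup>T - H\<^sup>T) (- T\<^sup>T)"

lemma X_carrier [simp]: "X \<in> carrier_mat N (n + n)"
  unfolding X_def by (simp add: hcat_carrier)

lemma Y_carrier [simp]: "Y \<in> carrier_mat (n + n) N"
  unfolding Y_def by (intro vcat_carrier) (auto intro: minus_carrier_mat)

lemma B_X: "B * X = X * K"
proof -
  have "B * X = hcat (H * A - T) (H * D - H)"
    unfolding X_def by (simp add: mult_hcat[of _ N N _ n _ n] B_H B_T)
  also have "H * A - T = H * A + T * (- 1\<^sub>m n)"
    by (intro eq_matI) (auto simp: T_def H_def)
  also have "H * D - H = H * (D - 1\<^sub>m n) + T * 0\<^sub>m n n"
    by (intro eq_matI) (auto simp: mult_minus_distrib_mat[of H N n D n])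
  also have "hcat (H * A + T * (- 1\<^sub>m n)) \<dots> = X * K"
    unfolding X_def K_matrix_def by (subst hcat_mult_four_block) (auto intro: minus_carrier_mat)
  finally show ?thesis .
qed

lemma K_Y: "K * Y = Y * B"
proof -
  let ?U = "A * T\<^sup>T - H\<^sup>T"
  have U: "?U \<in> carrier_mat n N" by (auto intro: minus_carrier_mat)
  have "K * Y = vcat (A * ?U + (D - 1\<^sub>m n) * (- T\<^sup>T)) (- 1\<^sub>m n * ?U + 0\<^sub>m n n * (- T\<^sup>T))"
    unfolding Y_def K_matrix_def using U by (intro four_block_mult_vcat) (auto intro: minus_carrier_mat)
  also have "A * ?U + (D - 1\<^sub>m n) * (- T\<^sup>T) = ?U * B"
  proof -
    have "?U * B = A * (T\<^sup>T * B) - H\<^sup>T * B"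
      by (simp add: minus_mult_distrib_mat[of "A * T\<^sup>T" n N "H\<^sup>T" B N] assoc_mult_mat[of _ n n _ N _ N])
    also have "\<dots> = A * ?U - (D * T\<^sup>T - T\<^sup>T)"
      by (simp only: T_transpose_B H_transpose_B)
    also have "D * T\<^sup>T - T\<^sup>T = (D - 1\<^sub>m n) * T\<^sup>T"
      by (simp add: minus_mult_distrib_mat[of _ n n _ _ N])
    also have "A * ?U - (D - 1\<^sub>m n) * T\<^sup>T = A * ?U + (D - 1\<^sub>m n) * (- T\<^sup>T)"
      using U by (intro eq_matI) (auto simp: minus_add_uminus_mat)
    finally show ?thesis by simp
  qed
  also have "- 1\<^sub>m n * ?U + 0\<^sub>m n n * (- T\<^sup>T) = - T\<^sup>T * B"
    using U by (auto simp: T_transpose_B)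
  also have "vcat (?U * B) (- T\<^sup>T * B) = Y * B"
    unfolding Y_def using U by (intro vcat_mult[symmetric]) auto
  finally show ?thesis .
qed

lemma X_Y: "X * Y = B * B - 1\<^sub>m N"
proof -
  let ?U = "A * T\<^sup>T - H\<^sup>T"
  have U: "?U \<in> carrier_mat n N" by (auto intro: minus_carrier_mat)
  have "X * Y = H * ?U + T * (- T\<^sup>T)"
    unfolding X_def Y_def using U by (intro hcat_mult_vcat[of _ N n _ n]) auto
  moreover have "B * B = H * (T\<^sup>T * B) - P * B"
    by (subst (1) B_eq) (simp add: minus_mult_distrib_mat[of _ N N _ _ N] assoc_mult_mat[of _ N n _ N _ N])
  ultimately show ?thesis
    unfolding T_transpose_B P_B using U by (intro eq_matI) (auto simp: T_def)
qed

lemma Y_X: "Y * X = K * K - 1\<^sub>m (n + n)"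
proof -
  let ?U = "A * T\<^sup>T - H\<^sup>T"
  have U: "?U \<in> carrier_mat n N" by (auto intro: minus_carrier_mat)
  have "Y * X = four_block_mat (?U * H) (?U * T) (- T\<^sup>T * H) (- T\<^sup>T * T)"
    unfolding X_def Y_def using U by (intro vcat_mult_hcat[of _ n N _ n _ n _ n]) auto
  also have "?U * H = A * A - D"
    by (simp add: minus_mult_distrib_mat[of _ n N _ _ n] assoc_mult_mat[of _ n n _ N _ n] T_transpose_H H_transpose_H)
  also have "?U * T = A * D - A"
    by (simp add: minus_mult_distrib_mat[of _ n N _ _ n] assoc_mult_mat[of _ n n _ N _ n] T_transpose_T H_transpose_T)
  also have "- T\<^sup>T * H = - A" by (simp add: T_transpose_H[symmetric])
  also have "- T\<^sup>T * T = - D" by (simp add: T_transpose_T[symmetric])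
  finally have YX: "Y * X = four_block_mat (A * A - D) (A * D - A) (- A) (- D)" .
  have "K * K = four_block_mat (A * A + (D - 1\<^sub>m n) * (- 1\<^sub>m n)) (A * (D - 1\<^sub>m n) + (D - 1\<^sub>m n) * 0\<^sub>m n n)
      (- 1\<^sub>m n * A + 0\<^sub>m n n * (- 1\<^sub>m n)) (- 1\<^sub>m n * (D - 1\<^sub>m n) + 0\<^sub>m n n * 0\<^sub>m n n)"
    unfolding K_matrix_def by (intro mult_four_block_mat) (auto intro: minus_carrier_mat)
  also have "\<dots> = four_block_mat (A * A - (D - 1\<^sub>m n)) (A * D - A) (- A) (1\<^sub>m n - D)"
  proof (intro cong_four_block_mat)
    show "A * A + (D - 1\<^sub>m n) * (- 1\<^sub>m n) = A * A - (D - 1\<^sub>m n)"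
      by (intro eq_matI) (auto simp: adjacency_matrix_def degree_matrix_def)
  next
    show "A * (D - 1\<^sub>m n) + (D - 1\<^sub>m n) * 0\<^sub>m n n = A * D - A"
      by (intro eq_matI) (auto simp: mult_minus_distrib_mat[of A n n D n] minus_carrier_mat)
  next
    show "- 1\<^sub>m n * A + 0\<^sub>m n n * (- 1\<^sub>m n) = - A" by (intro eq_matI) auto
  next
    show "- 1\<^sub>m n * (D - 1\<^sub>m n) + 0\<^sub>m n n * 0\<^sub>m n n = 1\<^sub>m n - D"
      by (intro eq_matI) (auto simp: degree_matrix_def)
  qed
  finally have KK: "K * K = four_block_mat (A * A - (D - 1\<^sub>m n)) (A * D - A) (- A) (1\<^sub>m n - D)" .
  show ?thesis
    unfolding YX KK by (intro eq_matI) (auto simp: adjacency_matrix_def degree_matrix_def)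
qed

end

section \<open>Gradients, circulations and cycles\<close>

lemma underdetermined_system:
  fixes R :: "'a::field mat"
  assumes R: "R \<in> carrier_mat m k" and "m < k"
  shows "\<exists>v \<in> carrier_vec k. v \<noteq> 0\<^sub>v k \<and> R *\<^sub>v v = 0\<^sub>v m"
proof -
  define S where "S = mat k k (\<lambda>(i, j). if i < m then R $$ (i, j) else 0)"
  have S: "S \<in> carrier_mat k k" by (simp add: S_def)
  have "S = mat\<^sub>r k k (\<lambda>i. if i = m then 0\<^sub>v k else row S i)"
    by (intro eq_matI) (auto simp: S_def)
  moreover have "det \<dots> = 0" by (rule det_row_0[OF \<open>m < k\<close>]) (auto simp: S_def)
  ultimately have "det S = 0" by simp
  then obtain v where v: "v \<in> carrier_vec k" "v \<noteq> 0\<^sub>v k" "S *\<^sub>v v = 0\<^sub>v k"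
    using det_0_iff_vec_prod_zero[OF S] by blast
  have "(R *\<^sub>v v) $ i = 0" if "i < m" for i
  proof -
    have "(R *\<^sub>v v) $ i = (S *\<^sub>v v) $ i"
      using that assms v(1) by (auto simp: S_def scalar_prod_def intro!: sum.cong)
    then show ?thesis using v(3) that \<open>m < k\<close> by simp
  qed
  then have "R *\<^sub>v v = 0\<^sub>v m" using R by (intro eq_vecI) auto
  then show ?thesis using v by blast
qed


context pair_graph
begin

lemma sum_arcs_swap: "(\<Sum>e\<in>parcs G. h (prod.swap e)) = (\<Sum>e\<in>parcs G. h e)"
  by (rule sum.reindex_bij_witness[of _ prod.swap prod.swap]) (auto intro: arcs_symmetric)

text \<open>
  Summation by parts: pairing a circulation with the gradient of \<open>x\<close> regroups into the net outflow
  at each vertex, weighted by \<open>x\<close>, and vanishes. A circulation that is a gradient is thus orthogonal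
  to itself.
\<close>

lemma gradient_orthogonal_to_flows:
  fixes x :: "'a \<Rightarrow> complex"
  assumes antisym: "\<And>u v. g (v, u) = - g (u, v)"
    and conserved: "\<And>u. (\<Sum>e | e \<in> parcs G \<and> fst e = u. g e) = 0"
    and grad: "\<And>u v. (u, v) \<in> parcs G \<Longrightarrow> x u - x v = g (u, v)"
    and e: "e \<in> parcs G"
  shows "g e = 0"
proof -
  have potential: "(\<Sum>e\<in>parcs G. g e * cnj (x (fst e))) = 0"
  proof -
    have "(\<Sum>e\<in>parcs G. g e * cnj (x (fst e)))
        = (\<Sum>u\<in>pverts G. \<Sum>e | e \<in> parcs G \<and> fst e = u. g e * cnj (x (fst e)))"
      by (rule sum.group[symmetric]) (use pair_finite_arcs pair_finite_verts in_arcsD1 in auto)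
    also have "\<dots> = (\<Sum>u\<in>pverts G. (\<Sum>e | e \<in> parcs G \<and> fst e = u. g e) * cnj (x u))"
      unfolding sum_distrib_right by (intro sum.cong) auto
    finally show ?thesis by (simp add: conserved)
  qed
  have "(\<Sum>e\<in>parcs G. g e * cnj (x (snd e))) = - (\<Sum>e\<in>parcs G. g e * cnj (x (fst e)))"
  proof -
    have "(\<Sum>e\<in>parcs G. g e * cnj (x (snd e))) = (\<Sum>e\<in>parcs G. g (prod.swap e) * cnj (x (snd (prod.swap e))))"
      by (rule sum_arcs_swap[symmetric])
    also have "\<dots> = (\<Sum>e\<in>parcs G. - (g e * cnj (x (fst e))))"
    proof (intro sum.cong refl)
      fix e :: "'a \<times> 'a"
      show "g (prod.swap e) * cnj (x (snd (prod.swap e))) = - (g e * cnj (x (fst e)))"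
        using antisym[of "snd e" "fst e"] by (cases e) simp
    qed
    finally show ?thesis by (simp add: sum_negf)
  qed
  then have "(\<Sum>e\<in>parcs G. g e * cnj (x (fst e)) - g e * cnj (x (snd e))) = 0"
    unfolding sum_subtractf using potential by simp
  also have "(\<Sum>e\<in>parcs G. g e * cnj (x (fst e)) - g e * cnj (x (snd e))) = (\<Sum>e\<in>parcs G. of_real ((cmod (g e))\<^sup>2))"
  proof (intro sum.cong refl)
    fix e assume "e \<in> parcs G"
    then have "g e = x (fst e) - x (snd e)" using grad[of "fst e" "snd e"] by simp
    then have "cnj (g e) = cnj (x (fst e)) - cnj (x (snd e))" by simp
    then have "g e * cnj (x (fst e)) - g e * cnj (x (snd e)) = g e * cnj (g e)"
      by (simp only: right_diff_distrib)
    then show "g e * cnj (x (fst e)) - g e * cnj (x (snd e)) = of_real ((cmod (g e))\<^sup>2)"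
      by (simp only: complex_norm_square)
  qed
  finally have "of_real (\<Sum>e\<in>parcs G. (cmod (g e))\<^sup>2) = (0 :: complex)" by simp
  then have "(\<Sum>e\<in>parcs G. (cmod (g e))\<^sup>2) = 0" by (simp only: of_real_eq_0_iff)
  then show ?thesis using e pair_finite_arcs by (simp add: sum_nonneg_eq_0_iff)
qed

end

text \<open>
  The relation \<open>lt\<close> chooses one of the two directions of every edge.
\<close>

lemma (in pair_graph) card_parcs_eq_twice_num_edges:
  fixes lt :: "'a \<Rightarrow> 'a \<Rightarrow> bool"
  assumes lt: "\<And>u v. u \<noteq> v \<Longrightarrow> lt u v \<longleftrightarrow> \<not> lt v u"
  shows "num_edges G = card {(u, v). (u, v) \<in> parcs G \<and> lt u v}"
    and "card (parcs G) = 2 * num_edges G"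
proof -
  let ?O = "{(u, v). (u, v) \<in> parcs G \<and> lt u v}"
  have fin: "finite ?O" by (rule finite_subset[OF _ pair_finite_arcs]) auto
  have "(\<lambda>(u, v). {u, v}) ` parcs G = (\<lambda>(u, v). {u, v}) ` ?O"
  proof (intro equalityI subsetI)
    fix d assume "d \<in> (\<lambda>(u, v). {u, v}) ` parcs G"
    then obtain u v where uv: "(u, v) \<in> parcs G" "d = {u, v}" by auto
    then have "u \<noteq> v" using no_loops' by blast
    then have "(u, v) \<in> ?O \<or> (v, u) \<in> ?O" using uv lt[of u v] arcs_symmetric by auto
    then show "d \<in> (\<lambda>(u, v). {u, v}) ` ?O" using uv by (auto simp: insert_commute image_iff)
  qed auto
  moreover have "inj_on (\<lambda>(u, v). {u, v}) ?O"
  proof (rule inj_onI)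
    fix d e assume de: "d \<in> ?O" "e \<in> ?O" and "(\<lambda>(u, v). {u, v}) d = (\<lambda>(u, v). {u, v}) e"
    then have "e = d \<or> e = prod.swap d" by (cases d; cases e) (auto simp: doubleton_eq_iff)
    moreover have "e \<noteq> prod.swap d"
    proof
      assume "e = prod.swap d"
      then have "lt (fst d) (snd d)" "lt (snd d) (fst d)" "fst d \<noteq> snd d"
        using de no_loops'[of "fst d" "snd d"] by auto
      then show False using lt[of "fst d" "snd d"] by simp
    qed
    ultimately show "d = e" by simp
  qed
  ultimately show num: "num_edges G = card ?O"
    unfolding num_edges_def by (simp add: card_image)
  have split: "parcs G = ?O \<union> prod.swap ` ?O"
  proof (intro equalityI subsetI)
    fix e assume e: "e \<in> parcs G"
    obtain u v where uv: "e = (u, v)" by force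
    then have "u \<noteq> v" using e no_loops' by blast
    then have "e \<in> ?O \<or> prod.swap e \<in> ?O" using e uv lt[of u v] arcs_symmetric by auto
    then show "e \<in> ?O \<union> prod.swap ` ?O" by (metis (no_types, lifting) UnI1 UnI2 image_eqI swap_swap)
  qed (auto intro: arcs_symmetric)
  moreover have "?O \<inter> prod.swap ` ?O = {}"
  proof -
    have False if "e \<in> ?O" "prod.swap e \<in> ?O" for e
    proof -
      have "lt (fst e) (snd e)" "lt (snd e) (fst e)" "fst e \<noteq> snd e"
        using that no_loops'[of "fst e" "snd e"] by auto
      then show False using lt[of "fst e" "snd e"] by simp
    qed
    then show ?thesis by force
  qed
  ultimately have "card (parcs G) = card ?O + card (prod.swap ` ?O)"
    using fin card_Un_disjoint[of ?O "prod.swap ` ?O"] by simp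
  then show "card (parcs G) = 2 * num_edges G"
    using num by (simp add: card_image)
qed


lemma sum_cyclic_shift:
  fixes h :: "nat \<Rightarrow> 'b::comm_monoid_add"
  assumes "0 < l"
  shows "(\<Sum>i<l. h (Suc i mod l)) = (\<Sum>i<l. h i)"
proof -
  obtain k where l: "l = Suc k" using assms by (cases l) auto
  have "(\<Sum>i<l. h (Suc i mod l)) = (\<Sum>i<k. h (Suc i)) + h 0"
    unfolding l sum.lessThan_Suc by (intro arg_cong2[of _ _ _ _ "(+)"] sum.cong) auto
  also have "\<dots> = (\<Sum>i<l. h i)"
    unfolding l sum.lessThan_Suc_shift by (simp add: add.commute)
  finally show ?thesis .
qed

text \<open>
  Send one unit of flow around the cycle. A length of at least 3 guarantees that no edge is traversed
  in both directions, so that nothing cancels and the support is the whole cycle.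
\<close>

lemma (in pair_graph) circulation_of_cycle:
  assumes "C \<in> cycle_subgraphs G"
  obtains g :: "'a \<times> 'a \<Rightarrow> complex" where "\<And>u v. g (v, u) = - g (u, v)"
    and "\<And>u. (\<Sum>e | e \<in> parcs G \<and> fst e = u. g e) = 0" and "{e. g e \<noteq> 0} = parcs C"
    and "parcs C \<subseteq> parcs G" and "pverts C = fst ` parcs C" and "parcs C \<noteq> {}"
proof -
  obtain vs where C: "C = cycle_graph vs" and dist: "distinct vs" and len: "3 \<le> length vs"
    and sub: "subgraph (with_proj C) (with_proj G)"
    using assms unfolding cycle_subgraphs_def by blast
  let ?l = "length vs"
  define nxt where "nxt i = Suc i mod ?l" for i
  define arc where "arc i = (vs ! i, vs ! nxt i)" for i
  define E where "E = arc ` {..<?l}"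
  have nxt: "nxt i < ?l" for i using len unfolding nxt_def by (intro mod_less_divisor) auto
  have E_fst: "fst e \<in> set vs" and E_snd: "snd e \<in> set vs" if "e \<in> E" for e
    using that nxt by (auto simp: E_def arc_def)
  have parcs_C: "parcs C = E \<union> prod.swap ` E"
    unfolding C cycle_graph_def E_def arc_def nxt_def by (auto simp: Let_def)
  have parcs_sub: "parcs C \<subseteq> parcs G" using sub by (auto simp: subgraph_def)
  have disjoint: "prod.swap e \<notin> E" if "e \<in> E" for e
  proof
    assume "prod.swap e \<in> E"
    with that obtain i j where ij: "i < ?l" "j < ?l" "e = arc i" "prod.swap e = arc j"
      unfolding E_def by auto
    then have "vs ! i = vs ! nxt j" "vs ! nxt i = vs ! j" by (auto simp: arc_def)
    then have "i = nxt j" "nxt i = j"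
      using nth_eq_iff_index_eq[OF dist] ij nxt by auto
    then have "nxt (nxt i) = i" by simp
    then show False
      using len ij(1) unfolding nxt_def by (auto simp: mod_Suc split: if_splits)
  qed
  define g :: "'a \<times> 'a \<Rightarrow> complex" where "g e = of_bool (e \<in> E) - of_bool (prod.swap e \<in> E)" for e
  have antisym: "g (v, u) = - g (u, v)" for u v by (simp add: g_def)
  have conserved: "(\<Sum>e | e \<in> parcs G \<and> fst e = u. g e) = 0" for u
  proof -
    have inj: "inj_on arc {..<?l}"
      using nth_eq_iff_index_eq[OF dist] by (auto simp: inj_on_def arc_def)
    have E_sum: "(\<Sum>e\<in>parcs G. of_bool (e \<in> E) * h e) = (\<Sum>i<?l. h (arc i))" for h :: "_ \<Rightarrow> complex"
    proof -
      have "(\<Sum>e\<in>parcs G. of_bool (e \<in> E) * h e) = (\<Sum>e\<in>E. h e)"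
        by (rule sum.mono_neutral_cong_right) (use pair_finite_arcs parcs_sub parcs_C in auto)
      then show ?thesis unfolding E_def by (simp add: sum.reindex[OF inj])
    qed
    have "(\<Sum>e | e \<in> parcs G \<and> fst e = u. g e) = (\<Sum>e\<in>parcs G. of_bool (fst e = u) * g e)"
      by (rule sum.mono_neutral_cong_left) (use pair_finite_arcs in auto)
    also have "\<dots> = (\<Sum>e\<in>parcs G. of_bool (e \<in> E) * of_bool (fst e = u))
        - (\<Sum>e\<in>parcs G. of_bool (prod.swap e \<in> E) * of_bool (snd (prod.swap e) = u))"
      unfolding sum_subtractf[symmetric] by (intro sum.cong) (auto simp: g_def)
    also have "(\<Sum>e\<in>parcs G. of_bool (prod.swap e \<in> E) * of_bool (snd (prod.swap e) = u))
        = (\<Sum>e\<in>parcs G. of_bool (e \<in> E) * of_bool (snd e = u) :: complex)"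
      by (rule sum_arcs_swap)
    also have "(\<Sum>e\<in>parcs G. of_bool (e \<in> E) * of_bool (fst e = u)) - \<dots>
        = (\<Sum>i<?l. of_bool (vs ! i = u)) - (\<Sum>i<?l. of_bool (vs ! nxt i = u))"
      unfolding E_sum by (simp add: arc_def)
    also have "\<dots> = 0"
      unfolding nxt_def using len by (subst sum_cyclic_shift[of ?l "\<lambda>i. of_bool (vs ! i = u)"]) auto
    finally show ?thesis .
  qed
  have support: "{e. g e \<noteq> 0} = parcs C"
  proof -
    have "g e \<noteq> 0 \<longleftrightarrow> e \<in> E \<or> prod.swap e \<in> E" for e
      using disjoint[of e] by (auto simp: g_def)
    moreover have "prod.swap e \<in> E \<longleftrightarrow> e \<in> prod.swap ` E" for e
      by (metis image_eqI imageE swap_swap)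
    ultimately show ?thesis unfolding parcs_C by blast
  qed
  have "set vs = fst ` parcs C"
  proof (intro equalityI subsetI)
    fix v assume "v \<in> set vs"
    then obtain i where "i < ?l" "v = vs ! i" by (metis in_set_conv_nth)
    then have "v = fst (arc i)" "arc i \<in> E" by (auto simp: E_def arc_def)
    then show "v \<in> fst ` parcs C" unfolding parcs_C by blast
  next
    fix v assume "v \<in> fst ` parcs C"
    then show "v \<in> set vs" using E_fst E_snd unfolding parcs_C by auto
  qed
  then have verts: "pverts C = fst ` parcs C" by (simp add: C cycle_graph_def)
  have "parcs C \<noteq> {}" using len unfolding parcs_C E_def by (auto simp: lessThan_empty_iff)
  then show ?thesis using that antisym conserved support parcs_sub verts by blast
qed

section \<open>Semisimplicity at the eigenvalues 1 and -1\<close>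

text \<open>
  The arithmetic in each coordinate behind \<open>B_semisimple\<close>: multiplying the second hypothesis by \<open>s\<close>
  shows \<open>s w = - s w\<close>.
\<close>

lemma sign_contradiction:
  fixes s w h q v :: complex
  assumes s: "s = 1 \<or> s = -1" and w: "w = h - q - s * v" and sw: "- s * w = s * h - v - s * q"
  shows "w = 0"
proof -
  have "s * w = s * h - s * q - v"
    using s by (subst w) auto
  also have "\<dots> = - s * w"
    unfolding sw by (simp only: diff_diff_eq add.commute)
  finally have "s * w + s * w = 0"
    by (simp only: mult_minus_left eq_neg_iff_add_eq_0)
  then have "2 * (s * w) = 0" by (simp only: mult_2)
  then show ?thesis using s by auto
qed

lemma transpose_scalar_prod:
  fixes M :: "'a::comm_semiring_0 mat"
  assumes "M \<in> carrier_mat k l" "x \<in> carrier_vec l" "y \<in> carrier_vec k"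
  shows "y \<bullet> (M *\<^sub>v x) = (M\<^sup>T *\<^sub>v y) \<bullet> x"
proof -
  have "y \<bullet> (M *\<^sub>v x) = (\<Sum>i<k. \<Sum>j<l. y $ i * (M $$ (i, j) * x $ j))"
    using assms by (auto simp: scalar_prod_def sum_distrib_left atLeast0LessThan intro!: sum.cong)
  also have "\<dots> = (\<Sum>j<l. \<Sum>i<k. y $ i * (M $$ (i, j) * x $ j))"
    by (rule sum.swap)
  also have "\<dots> = (M\<^sup>T *\<^sub>v y) \<bullet> x"
    using assms by (auto simp: scalar_prod_def sum_distrib_right sum_distrib_left atLeast0LessThan ac_simps intro!: sum.cong)
  finally show ?thesis .
qed

context listed_graph
begin

lemma zero_vec_append: "0\<^sub>v k @\<^sub>v 0\<^sub>v l = (0\<^sub>v (k + l) :: 'b::zero vec)"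
  by (intro eq_vecI) auto

lemma mult_vec_carriers [simp]:
  "z \<in> carrier_vec n \<Longrightarrow> T *\<^sub>v z \<in> carrier_vec N" "z \<in> carrier_vec n \<Longrightarrow> H *\<^sub>v z \<in> carrier_vec N"
  "z \<in> carrier_vec n \<Longrightarrow> A *\<^sub>v z \<in> carrier_vec n" "z \<in> carrier_vec n \<Longrightarrow> D *\<^sub>v z \<in> carrier_vec n"
  "v \<in> carrier_vec N \<Longrightarrow> T\<^sup>T *\<^sub>v v \<in> carrier_vec n" "v \<in> carrier_vec N \<Longrightarrow> H\<^sup>T *\<^sub>v v \<in> carrier_vec n"
  "v \<in> carrier_vec N \<Longrightarrow> P *\<^sub>v v \<in> carrier_vec N" "v \<in> carrier_vec N \<Longrightarrow> B *\<^sub>v v \<in> carrier_vec N"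
  by (auto intro!: carrier_vecI)

lemma T_entry: "z \<in> carrier_vec n \<Longrightarrow> p < N \<Longrightarrow> (T *\<^sub>v z) $ p = z $ (fst (es ! p) - 1)"
  and H_entry: "z \<in> carrier_vec n \<Longrightarrow> p < N \<Longrightarrow> (H *\<^sub>v z) $ p = z $ (snd (es ! p) - 1)"
proof -
  assume z: "z \<in> carrier_vec n" and p: "p < N"
  have *: "(\<Sum>i<n. of_bool (u = Suc i) * z $ i) = z $ (u - 1)" if "u \<in> {1..n}" for u
  proof -
    have "(\<Sum>i<n. of_bool (u = Suc i) * z $ i) = (\<Sum>i<n. if i = u - 1 then z $ i else 0)"
      using that by (intro sum.cong) auto
    then show ?thesis using that by auto
  qed
  have "fst (es ! p) \<in> {1..n}" "snd (es ! p) \<in> {1..n}"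
    using arc_fst_in_verts[OF nth_es_arc[OF p]] arc_snd_in_verts[OF nth_es_arc[OF p]] verts_eq by auto
  note * = this[THEN *]
  show "(T *\<^sub>v z) $ p = z $ (fst (es ! p) - 1)"
    using p z *(1) by (simp add: T_def scalar_prod_def atLeast0LessThan)
  show "(H *\<^sub>v z) $ p = z $ (snd (es ! p) - 1)"
    using p z *(2) by (simp add: H_def scalar_prod_def atLeast0LessThan)
qed

text \<open>
  For \<open>w = (T - s H) z\<close> the hypothesis says that \<open>T\<^sup>T w\<close> and \<open>H\<^sup>T w\<close> vanish, so \<open>w\<close> is orthogonal
  to the columns of \<open>T\<close> and \<open>H\<close>. These are real, so \<open>w\<close> is also orthogonal to the conjugate of \<open>w\<close>.
\<close>

lemma signed_laplacian_kernel:
  assumes z: "z \<in> carrier_vec n" and s: "s = 1 \<or> s = -1"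
    and Az: "A *\<^sub>v z = s \<cdot>\<^sub>v (D *\<^sub>v z)"
  shows "T *\<^sub>v z = s \<cdot>\<^sub>v (H *\<^sub>v z)"
proof -
  define w where "w = T *\<^sub>v z - s \<cdot>\<^sub>v (H *\<^sub>v z)"
  have w: "w \<in> carrier_vec N" and cz: "conjugate z \<in> carrier_vec n" using z by (auto simp: w_def intro!: carrier_vecI)
  have "T\<^sup>T *\<^sub>v w = D *\<^sub>v z - s \<cdot>\<^sub>v (A *\<^sub>v z)"
    unfolding w_def using z
    by (simp add: mult_minus_distrib_mat_vec[of _ n N] mult_mat_vec[of _ n N] T_transpose_T T_transpose_H
        assoc_mult_mat_vec[of _ n N _ n, symmetric])
  then have Tw: "T\<^sup>T *\<^sub>v w = 0\<^sub>v n" using s z unfolding Az by (auto simp: vec_eq_iff)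
  have "H\<^sup>T *\<^sub>v w = A *\<^sub>v z - s \<cdot>\<^sub>v (D *\<^sub>v z)"
    unfolding w_def using z
    by (simp add: mult_minus_distrib_mat_vec[of _ n N] mult_mat_vec[of _ n N] H_transpose_T H_transpose_H
        assoc_mult_mat_vec[of _ n N _ n, symmetric])
  then have Hw: "H\<^sup>T *\<^sub>v w = 0\<^sub>v n" using s z unfolding Az by (auto simp: vec_eq_iff)
  have "fst (es ! p) - 1 < n" "snd (es ! p) - 1 < n" if "p < N" for p
    using arc_fst_in_verts[OF nth_es_arc[OF that]] arc_snd_in_verts[OF nth_es_arc[OF that]] verts_eq
    by auto
  note this[simp]
  have "conjugate w = T *\<^sub>v conjugate z - s \<cdot>\<^sub>v (H *\<^sub>v conjugate z)"
    using s z cz unfolding w_def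
    by (intro eq_vecI) (auto simp: T_entry H_entry simp del: index_mult_mat_vec One_nat_def)
  then have "w \<bullet> conjugate w = w \<bullet> (T *\<^sub>v conjugate z) - s * (w \<bullet> (H *\<^sub>v conjugate z))"
    using w cz by (simp add: scalar_prod_minus_distrib[of _ N])
  also have "\<dots> = 0"
    using w cz by (simp add: transpose_scalar_prod[of _ N n] Tw Hw)
  finally have "w = 0\<^sub>v N" using conjugate_square_eq_0_vec[OF w] by simp
  then show ?thesis
    using z unfolding w_def by (auto simp: vec_eq_iff)
qed

lemma K_mult_append:
  assumes a: "a \<in> carrier_vec n" and b: "b \<in> carrier_vec n"
  shows "K *\<^sub>v (a @\<^sub>v b) = (A *\<^sub>v a + (D *\<^sub>v b - b)) @\<^sub>v (- a)"
proof -
  have "K *\<^sub>v (a @\<^sub>v b) = (A *\<^sub>v a + (D - 1\<^sub>m n) *\<^sub>v b) @\<^sub>v (- 1\<^sub>m n *\<^sub>v a + 0\<^sub>m n n *\<^sub>v b)"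
    unfolding K_matrix_def using a b by (intro four_block_mat_mult_vec) (auto intro: minus_carrier_mat)
  also have "(D - 1\<^sub>m n) *\<^sub>v b = D *\<^sub>v b - b"
    using b by (simp add: minus_mult_distrib_mat_vec[of D n n])
  also have "- 1\<^sub>m n *\<^sub>v a + 0\<^sub>m n n *\<^sub>v b = - a"
    using a b by (intro eq_vecI) auto
  finally show ?thesis .
qed

lemma char_K_mult_append:
  assumes a: "a \<in> carrier_vec n" and b: "b \<in> carrier_vec n"
  shows "char_matrix K s *\<^sub>v (a @\<^sub>v b) = (A *\<^sub>v a + (D *\<^sub>v b - b) - s \<cdot>\<^sub>v a) @\<^sub>v (- a - s \<cdot>\<^sub>v b)"
proof -
  have "char_matrix K s *\<^sub>v (a @\<^sub>v b) = K *\<^sub>v (a @\<^sub>v b) - s \<cdot>\<^sub>v (a @\<^sub>v b)"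
    using a b by (intro char_matrix_mult_vec) auto
  then show ?thesis
    unfolding K_mult_append[OF a b] using a b by (intro eq_vecI) auto
qed

lemma K_eigenvector:
  assumes a: "a \<in> carrier_vec n" and b: "b \<in> carrier_vec n" and s: "s = 1 \<or> s = -1"
    and Kab: "char_matrix K s *\<^sub>v (a @\<^sub>v b) = 0\<^sub>v (n + n)"
  shows "a = - s \<cdot>\<^sub>v b" and "b = - s \<cdot>\<^sub>v a" and "A *\<^sub>v a = s \<cdot>\<^sub>v (D *\<^sub>v a)"
proof -
  have "(A *\<^sub>v a + (D *\<^sub>v b - b) - s \<cdot>\<^sub>v a) @\<^sub>v (- a - s \<cdot>\<^sub>v b) = 0\<^sub>v n @\<^sub>v 0\<^sub>v n"
    using Kab unfolding char_K_mult_append[OF a b] by (simp add: zero_vec_append)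
  moreover have "A *\<^sub>v a + (D *\<^sub>v b - b) - s \<cdot>\<^sub>v a \<in> carrier_vec n" using a b by auto
  ultimately have 1: "A *\<^sub>v a + (D *\<^sub>v b - b) - s \<cdot>\<^sub>v a = 0\<^sub>v n" and 2: "- a - s \<cdot>\<^sub>v b = 0\<^sub>v n"
    using append_vec_eq[OF _ zero_carrier_vec] by blast+
  have 2: "- a $ i - s * b $ i = 0" if "i < n" for i
    using arg_cong[OF 2, of "\<lambda>v. v $ i"] a b that by auto
  have a_entry: "a $ i = - s * b $ i" if "i < n" for i
  proof -
    have "a $ i = - (- a $ i - s * b $ i) - s * b $ i" by simp
    then show ?thesis unfolding 2[OF that] by simp
  qed
  then show "a = - s \<cdot>\<^sub>v b" using a b by (intro eq_vecI) auto
  have b_entry: "b $ i = - s * a $ i" if "i < n" for i using a_entry[OF that] s by auto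
  with a b show b_eq: "b = - s \<cdot>\<^sub>v a" by (intro eq_vecI) auto
  have Db: "D *\<^sub>v b = - s \<cdot>\<^sub>v (D *\<^sub>v a)"
    unfolding b_eq using a by (rule mult_mat_vec[of _ n n, OF carriers(7)])
  have "(A *\<^sub>v a) $ i = s * (D *\<^sub>v a) $ i" if "i < n" for i
  proof -
    have "(A *\<^sub>v a) $ i + ((- s \<cdot>\<^sub>v (D *\<^sub>v a)) $ i - b $ i) - s * a $ i = 0"
      using arg_cong[OF 1, of "\<lambda>v. v $ i"] a b that unfolding Db by (auto simp del: index_mult_mat_vec)
    then have "(A *\<^sub>v a) $ i + (- s * (D *\<^sub>v a) $ i - b $ i) - s * a $ i = 0"
      using that by (simp del: index_mult_mat_vec)
    moreover have "b $ i + s * a $ i = 0" using b_entry[OF that] by simp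
    moreover have "(A *\<^sub>v a) $ i = ((A *\<^sub>v a) $ i + (- s * (D *\<^sub>v a) $ i - b $ i) - s * a $ i)
        + s * (D *\<^sub>v a) $ i + (b $ i + s * a $ i)"
      by simp
    ultimately show ?thesis by (metis add_0 add.right_neutral)
  qed
  then show "A *\<^sub>v a = s \<cdot>\<^sub>v (D *\<^sub>v a)"
    using a b by (intro eq_vecI) (auto simp del: index_mult_mat_vec)
qed

lemma A_symmetric: "x \<in> carrier_vec n \<Longrightarrow> y \<in> carrier_vec n \<Longrightarrow> x \<bullet> (A *\<^sub>v y) = (A *\<^sub>v x) \<bullet> y"
  by (simp add: transpose_scalar_prod[of A n n] A_transpose)

lemma D_symmetric: "x \<in> carrier_vec n \<Longrightarrow> y \<in> carrier_vec n \<Longrightarrow> x \<bullet> (D *\<^sub>v y) = (D *\<^sub>v x) \<bullet> y"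
proof -
  have "D\<^sup>T = D" by (intro eq_matI) (auto simp: degree_matrix_def)
  then show "x \<in> carrier_vec n \<Longrightarrow> y \<in> carrier_vec n \<Longrightarrow> ?thesis"
    by (simp add: transpose_scalar_prod[of D n n])
qed

lemma D_quadratic_form:
  assumes z: "z \<in> carrier_vec n"
  shows "z \<bullet> (D *\<^sub>v z) = (T *\<^sub>v z) \<bullet> (T *\<^sub>v z)"
proof -
  have "(T *\<^sub>v z) \<bullet> (T *\<^sub>v z) = (D *\<^sub>v z) \<bullet> z"
    using z by (simp add: transpose_scalar_prod[of T N n] T_transpose_T assoc_mult_mat_vec[of _ n N _ n, symmetric])
  then show ?thesis using z by (simp add: D_symmetric)
qed

end

locale connected_listed_graph = listed_graph +
  assumes connected: "Digraph_Component.connected (with_proj G)"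
begin

lemma constant_if_arcwise_constant:
  assumes "\<And>e. e \<in> parcs G \<Longrightarrow> f (fst e) = f (snd e)" and "u \<in> pverts G" "v \<in> pverts G"
  shows "f u = f v"
proof -
  have "(u, v) \<in> rtrancl_on (pverts G) ((parcs G)\<^sup>s)"
    using connected assms(2,3) unfolding connected_conv by simp
  then show ?thesis
  proof (induction rule: rtrancl_on_induct)
    case (step y z)
    then have "(y, z) \<in> parcs G \<or> (z, y) \<in> parcs G" by (auto simp: symcl_def)
    then show ?case using step assms(1)[of "(y, z)"] assms(1)[of "(z, y)"] by auto
  qed simp
qed

text \<open>
  The square of \<open>z\<close> is constant on the connected graph, say \<open>c\<close>. The two sides of
  \<open>z \<bullet> D z = 2 (z \<bullet> z)\<close> are then \<open>N * c\<close> and \<open>2 * n * c\<close>, where \<open>N\<close> counts directed edges.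
\<close>

lemma isotropic_imp_zero:
  assumes z: "z \<in> carrier_vec n" and s: "s = 1 \<or> s = -1" and Tz: "T *\<^sub>v z = s \<cdot>\<^sub>v (H *\<^sub>v z)"
    and iso: "z \<bullet> (D *\<^sub>v z) = 2 * (z \<bullet> z)" and N: "N \<noteq> 2 * n"
  shows "z = 0\<^sub>v n"
proof (cases "n = 0")
  case False
  define c where "c = (z $ 0)\<^sup>2"
  have entry: "z $ (fst (es ! p) - 1) = s * z $ (snd (es ! p) - 1)" if "p < N" for p
  proof -
    have "(T *\<^sub>v z) $ p = s * (H *\<^sub>v z) $ p"
      using arg_cong[OF Tz, of "\<lambda>v. v $ p"] that by (simp del: index_mult_mat_vec)
    then show ?thesis using that z T_entry[OF z that] H_entry[OF z that] by simp
  qed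
  have arc: "z $ (fst e - 1) = s * z $ (snd e - 1)" if "e \<in> parcs G" for e
    using entry that set_es by (metis in_set_conv_nth)
  have "(z $ (fst e - 1))\<^sup>2 = (z $ (snd e - 1))\<^sup>2" if "e \<in> parcs G" for e
    using arc[OF that] s by auto
  then have const: "(z $ (u - 1))\<^sup>2 = (z $ (v - 1))\<^sup>2" if "u \<in> pverts G" "v \<in> pverts G" for u v
    using that by (rule constant_if_arcwise_constant[where f = "\<lambda>u. (z $ (u - 1))\<^sup>2"])
  have c: "(z $ i)\<^sup>2 = c" if "i < n" for i
    using const[of "Suc i" 1] that False by (simp add: verts_eq c_def)
  have "z \<bullet> z = (\<Sum>i<n. (z $ i)\<^sup>2)"
    using z by (auto simp: scalar_prod_def power2_eq_square atLeast0LessThan)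
  then have zz: "z \<bullet> z = of_nat n * c" using c by simp
  have "z \<bullet> (D *\<^sub>v z) = (\<Sum>p<N. (z $ (fst (es ! p) - 1))\<^sup>2)"
    unfolding D_quadratic_form[OF z] using z
    by (simp add: scalar_prod_def power2_eq_square atLeast0LessThan T_entry del: index_mult_mat_vec)
  also have "\<dots> = (\<Sum>p<N. c)"
  proof (intro sum.cong refl)
    fix p assume "p \<in> {..<N}"
    then have "fst (es ! p) \<in> {1..n}" using arc_fst_in_verts[OF nth_es_arc] verts_eq by auto
    then have "fst (es ! p) - 1 < n" by auto
    then show "(z $ (fst (es ! p) - 1))\<^sup>2 = c" by (rule c)
  qed
  also have "\<dots> = of_nat N * c" by simp
  finally have "of_nat N * c = 2 * (of_nat n * c)" by (metis iso zz)
  moreover have "(of_nat N - of_nat (2 * n)) * c = of_nat N * c - 2 * (of_nat n * c)"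
    by (simp only: left_diff_distrib of_nat_mult of_nat_numeral mult.assoc)
  ultimately have "(of_nat N - of_nat (2 * n)) * c = 0" by (simp only: diff_self)
  moreover have "of_nat N - of_nat (2 * n) \<noteq> (0 :: complex)" using N by (metis of_nat_eq_iff right_minus_eq)
  ultimately have "c = 0" by simp
  then show ?thesis using c z by (intro eq_vecI) auto
qed (use z in auto)

text \<open>
  Write \<open>(K - s) w = (a, b)\<close> with \<open>w = (x, y)\<close>. Then \<open>(a, b)\<close> is an eigenvector, so \<open>b = - s a\<close> and
  \<open>A a = s D a\<close>. Eliminating \<open>x\<close> turns the first component into \<open>2 a = D a + (D - s A) y\<close>. As \<open>a\<close>
  lies in the kernel of the symmetric matrix \<open>D - s A\<close>, pairing with \<open>a\<close> removes \<open>y\<close>.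
\<close>

lemma K_semisimple:
  assumes s: "s = 1 \<or> s = -1" and N: "N \<noteq> 2 * n" and w: "w \<in> carrier_vec (n + n)"
    and ker: "char_matrix K s *\<^sub>v (char_matrix K s *\<^sub>v w) = 0\<^sub>v (n + n)"
  shows "char_matrix K s *\<^sub>v w = 0\<^sub>v (n + n)"
proof -
  define x y where "x = vec_first w n" "y = vec_last w n"
  have xy: "x \<in> carrier_vec n" "y \<in> carrier_vec n" and w_eq: "w = x @\<^sub>v y"
    using w by (auto simp: x_y_def)
  define a b where "a = A *\<^sub>v x + (D *\<^sub>v y - y) - s \<cdot>\<^sub>v x" "b = - x - s \<cdot>\<^sub>v y"
  have ab: "a \<in> carrier_vec n" "b \<in> carrier_vec n" using xy by (auto simp: a_b_def)
  have Cw: "char_matrix K s *\<^sub>v w = a @\<^sub>v b"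
    unfolding w_eq a_b_def by (rule char_K_mult_append) (use xy in auto)
  note ev = K_eigenvector[OF ab s ker[unfolded Cw]]
  have Ta: "T *\<^sub>v a = s \<cdot>\<^sub>v (H *\<^sub>v a)"
    by (rule signed_laplacian_kernel[OF ab(1) s ev(3)])
  have b_entry: "b $ i = - s * a $ i" if "i < n" for i
    using that ab by (subst ev(2)) auto
  have x_eq: "x = s \<cdot>\<^sub>v (a - y)"
  proof (intro eq_vecI)
    fix i assume "i < dim_vec (s \<cdot>\<^sub>v (a - y))"
    then have i: "i < n" using xy by auto
    have "- x $ i - s * y $ i = - s * a $ i"
      using b_entry[OF i] i xy by (simp add: a_b_def)
    moreover have "x $ i = - (- x $ i - s * y $ i) - s * y $ i" by simp
    ultimately have "x $ i = s * (a $ i - y $ i)" by (simp add: right_diff_distrib)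
    then show "x $ i = (s \<cdot>\<^sub>v (a - y)) $ i" using i xy by simp
  qed (use ab xy in auto)
  have "A *\<^sub>v x = s \<cdot>\<^sub>v (A *\<^sub>v a - A *\<^sub>v y)"
    unfolding x_eq using ab xy by (simp add: mult_mat_vec[of _ n n] mult_minus_distrib_mat_vec[of _ n n])
  then have "a \<bullet> (A *\<^sub>v x) = s * (a \<bullet> (A *\<^sub>v a) - a \<bullet> (A *\<^sub>v y))"
    using ab xy by (simp add: scalar_prod_minus_distrib[of _ n])
  moreover have "a \<bullet> (A *\<^sub>v a) = s * (a \<bullet> (D *\<^sub>v a))"
    unfolding ev(3) using ab by simp
  ultimately have Ax: "a \<bullet> (A *\<^sub>v x) = a \<bullet> (D *\<^sub>v a) - s * (a \<bullet> (A *\<^sub>v y))"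
    using s by auto
  have Ay: "a \<bullet> (A *\<^sub>v y) = s * (a \<bullet> (D *\<^sub>v y))"
    using ab xy A_symmetric[OF ab(1) xy(2)] D_symmetric[OF ab(1) xy(2)] unfolding ev(3) by simp
  have ax: "a \<bullet> x = s * (a \<bullet> a - a \<bullet> y)"
    by (subst x_eq) (use ab xy in \<open>simp add: scalar_prod_minus_distrib[of _ n]\<close>)
  have "a \<bullet> a = a \<bullet> (A *\<^sub>v x) + (a \<bullet> (D *\<^sub>v y) - a \<bullet> y) - s * (a \<bullet> x)"
  proof -
    have "a \<bullet> a = a \<bullet> (A *\<^sub>v x + (D *\<^sub>v y - y) - s \<cdot>\<^sub>v x)"
      unfolding a_b_def(1)[symmetric] ..
    also have "\<dots> = a \<bullet> (A *\<^sub>v x + (D *\<^sub>v y - y)) - a \<bullet> (s \<cdot>\<^sub>v x)"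
      using ab xy by (intro scalar_prod_minus_distrib[of _ n]) auto
    also have "a \<bullet> (A *\<^sub>v x + (D *\<^sub>v y - y)) = a \<bullet> (A *\<^sub>v x) + a \<bullet> (D *\<^sub>v y - y)"
      using ab xy by (intro scalar_prod_add_distrib[of _ n]) auto
    also have "a \<bullet> (D *\<^sub>v y - y) = a \<bullet> (D *\<^sub>v y) - a \<bullet> y"
      using ab xy by (intro scalar_prod_minus_distrib[of _ n]) auto
    also have "a \<bullet> (s \<cdot>\<^sub>v x) = s * (a \<bullet> x)"
      using ab xy by simp
    finally show ?thesis .
  qed
  then have "a \<bullet> (D *\<^sub>v a) = 2 * (a \<bullet> a)"
    unfolding Ax Ay ax using s by (elim disjE) (simp_all add: algebra_simps)
  then have "a = 0\<^sub>v n" by (rule isotropic_imp_zero[OF ab(1) s Ta _ N])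
  moreover from this have "b = 0\<^sub>v n" using ev(2) by auto
  ultimately show ?thesis unfolding Cw by auto
qed

text \<open>
  Let \<open>w = (B - s) v\<close>. Then \<open>Y v\<close> lies in the kernel of \<open>(K - s)\<^sup>2\<close>, hence in that of \<open>K - s\<close>, so
  \<open>Y w = 0\<close> and therefore \<open>T\<^sup>T w = 0\<close> and \<open>P w = - s w\<close>. With \<open>x = T\<^sup>T v\<close>, which satisfies
  \<open>T x = s H x\<close>, applying \<open>P\<close> to \<open>w = H x - P v - s v\<close> gives \<open>P w = s w\<close> instead.
\<close>

lemma B_semisimple:
  assumes s: "s = 1 \<or> s = -1" and N: "N \<noteq> 2 * n" and v: "v \<in> carrier_vec N"
    and ker: "char_matrix B s *\<^sub>v (char_matrix B s *\<^sub>v v) = 0\<^sub>v N"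
  shows "char_matrix B s *\<^sub>v v = 0\<^sub>v N"
proof -
  define w where "w = char_matrix B s *\<^sub>v v"
  note ker = ker[folded w_def]
  have w: "w \<in> carrier_vec N" unfolding w_def using v by (intro mult_mat_vec_carrier) auto
  have Yv: "Y *\<^sub>v v \<in> carrier_vec (n + n)" using v by (intro mult_mat_vec_carrier) auto
  have comm: "char_matrix K s *\<^sub>v (Y *\<^sub>v u) = Y *\<^sub>v (char_matrix B s *\<^sub>v u)" if "u \<in> carrier_vec N" for u
    by (rule char_matrix_intertwine[OF carriers(8,9) Y_carrier K_Y that])
  have "char_matrix K s *\<^sub>v (char_matrix K s *\<^sub>v (Y *\<^sub>v v)) = 0\<^sub>v (n + n)"
    unfolding comm[OF v] w_def[symmetric] comm[OF w] ker by (rule mult_mat_zero_vec) simp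
  then have KYv: "char_matrix K s *\<^sub>v (Y *\<^sub>v v) = 0\<^sub>v (n + n)"
    using K_semisimple[OF s N Yv] by blast
  have Y_mult: "Y *\<^sub>v u = (A *\<^sub>v (T\<^sup>T *\<^sub>v u) - H\<^sup>T *\<^sub>v u) @\<^sub>v (- (T\<^sup>T *\<^sub>v u))" if "u \<in> carrier_vec N" for u
  proof -
    have "Y *\<^sub>v u = ((A * T\<^sup>T - H\<^sup>T) *\<^sub>v u) @\<^sub>v (- T\<^sup>T *\<^sub>v u)"
      unfolding Y_def using that by (intro vcat_mult_vec) auto
    then show ?thesis using that
      by (simp add: minus_mult_distrib_mat_vec[of _ n N] assoc_mult_mat_vec[of _ n n _ N])
  qed
  have Yw: "Y *\<^sub>v w = 0\<^sub>v (n + n)" using KYv comm[OF v] by (simp add: w_def)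
  then have "(A *\<^sub>v (T\<^sup>T *\<^sub>v w) - H\<^sup>T *\<^sub>v w) @\<^sub>v (- (T\<^sup>T *\<^sub>v w)) = 0\<^sub>v n @\<^sub>v 0\<^sub>v n"
    unfolding Y_mult[OF w] by (simp add: zero_vec_append)
  moreover have "A *\<^sub>v (T\<^sup>T *\<^sub>v w) - H\<^sup>T *\<^sub>v w \<in> carrier_vec n" using w by auto
  ultimately have neg: "- (T\<^sup>T *\<^sub>v w) = 0\<^sub>v n"
    using append_vec_eq[OF _ zero_carrier_vec] by blast
  have "(T\<^sup>T *\<^sub>v w) $ i = 0" if "i < n" for i
    using arg_cong[OF neg, of "\<lambda>u. u $ i"] that by (simp del: index_mult_mat_vec)
  then have Tw: "T\<^sup>T *\<^sub>v w = 0\<^sub>v n" by (intro eq_vecI) (auto simp del: index_mult_mat_vec)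
  define x where "x = T\<^sup>T *\<^sub>v v"
  have x: "x \<in> carrier_vec n" using v by (auto simp: x_def intro!: carrier_vecI)
  have B_mult: "B *\<^sub>v u = H *\<^sub>v (T\<^sup>T *\<^sub>v u) - P *\<^sub>v u" if "u \<in> carrier_vec N" for u
    unfolding B_eq using that
    by (simp add: minus_mult_distrib_mat_vec[of _ N N] assoc_mult_mat_vec[of _ N n _ N])
  have Pw: "(P *\<^sub>v w) $ p = - s * w $ p" if p: "p < N" for p
  proof -
    have "B *\<^sub>v w = s \<cdot>\<^sub>v w"
      using ker char_matrix_mult_vec_eq_0_iff[OF carriers(8) w] by simp
    then have "(H *\<^sub>v 0\<^sub>v n - P *\<^sub>v w) $ p = (s \<cdot>\<^sub>v w) $ p"
      unfolding B_mult[OF w] Tw by simp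
    moreover have "H *\<^sub>v 0\<^sub>v n = 0\<^sub>v N" by (rule mult_mat_zero_vec) simp
    ultimately have "- (P *\<^sub>v w) $ p = s * w $ p"
      using p w by (simp add: carrier_vecD del: index_mult_mat_vec)
    then show ?thesis by (metis minus_minus mult_minus_left)
  qed
  have Tx: "(T *\<^sub>v x) $ p = s * (H *\<^sub>v x) $ p" if p: "p < N" for p
  proof -
    let ?a = "A *\<^sub>v x - H\<^sup>T *\<^sub>v v"
    have a: "?a \<in> carrier_vec n" and mx: "- x \<in> carrier_vec n" using x by (auto intro!: carrier_vecI)
    note ev = K_eigenvector[OF a mx s KYv[unfolded Y_mult[OF v], folded x_def]]
    have "T *\<^sub>v ?a = s \<cdot>\<^sub>v (H *\<^sub>v ?a)" by (rule signed_laplacian_kernel[OF a s ev(3)])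
    moreover have "?a = s \<cdot>\<^sub>v x" by (subst ev(1)) (auto intro!: eq_vecI)
    ultimately have "T *\<^sub>v (s \<cdot>\<^sub>v x) = s \<cdot>\<^sub>v (H *\<^sub>v (s \<cdot>\<^sub>v x))" by simp
    then have "s \<cdot>\<^sub>v (T *\<^sub>v x) = s \<cdot>\<^sub>v (s \<cdot>\<^sub>v (H *\<^sub>v x))"
      using x by (simp add: mult_mat_vec[of _ N n])
    from arg_cong[OF this, of "\<lambda>u. u $ p"] have "s * (T *\<^sub>v x) $ p = s * (s * (H *\<^sub>v x) $ p)"
      using p by (simp del: index_mult_mat_vec)
    then show ?thesis using s by auto
  qed
  have w_eq: "w = H *\<^sub>v x - P *\<^sub>v v - s \<cdot>\<^sub>v v"
    using char_matrix_mult_vec[OF carriers(8) v] B_mult[OF v] by (simp add: x_def w_def)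
  have "P *\<^sub>v w = P *\<^sub>v (H *\<^sub>v x - P *\<^sub>v v) - P *\<^sub>v (s \<cdot>\<^sub>v v)"
    unfolding w_eq using v x by (intro mult_minus_distrib_mat_vec[of _ N N]) auto
  also have "P *\<^sub>v (H *\<^sub>v x - P *\<^sub>v v) = P *\<^sub>v (H *\<^sub>v x) - P *\<^sub>v (P *\<^sub>v v)"
    using v x by (intro mult_minus_distrib_mat_vec[of _ N N]) auto
  also have "P *\<^sub>v (s \<cdot>\<^sub>v v) = s \<cdot>\<^sub>v (P *\<^sub>v v)"
    using v by (intro mult_mat_vec[of _ N N]) auto
  also have "P *\<^sub>v (H *\<^sub>v x) = T *\<^sub>v x"
    using x by (simp add: assoc_mult_mat_vec[of _ N N _ n, symmetric] P_H)
  also have "P *\<^sub>v (P *\<^sub>v v) = v"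
    using v by (simp add: assoc_mult_mat_vec[of _ N N _ N, symmetric] P_P)
  finally have Pw': "P *\<^sub>v w = T *\<^sub>v x - v - s \<cdot>\<^sub>v (P *\<^sub>v v)" .
  have "w $ p = 0" if p: "p < N" for p
  proof -
    have "w $ p = (H *\<^sub>v x) $ p - (P *\<^sub>v v) $ p - s * v $ p"
      unfolding w_eq using p v by (simp del: index_mult_mat_vec)
    moreover have "- s * w $ p = s * (H *\<^sub>v x) $ p - v $ p - s * (P *\<^sub>v v) $ p"
      using Pw[OF p] arg_cong[OF Pw', of "\<lambda>u. u $ p"] p v Tx[OF p] by (simp del: index_mult_mat_vec)
    ultimately show ?thesis by (rule sign_contradiction[OF s])
  qed
  then show ?thesis unfolding w_def[symmetric] using w by (intro eq_vecI) (auto simp del: index_mult_mat_vec)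
qed


section \<open>A connected graph with two cycles has more edges than vertices\<close>

lemma n_pos: "0 < n"
  using connected verts_eq unfolding connected_conv by (cases "n = 0") auto

text \<open>
  If there were at most \<open>n\<close> edges, the linear system that expresses a combination of \<open>g\<close> and \<open>h\<close> as a
  gradient would have \<open>n + 1\<close> unknowns, namely the potentials of all vertices but the last and the
  two coefficients, against at most \<open>n\<close> equations, one for each edge. A nontrivial solution is a
  circulation that is also a gradient, so it vanishes. Hence the potential is constant, equal to its
  value 0 at the last vertex, and \<open>g\<close> and \<open>h\<close> are proportional, contradicting their supports.
\<close>

lemma independent_circulations_bound:
  fixes g h :: "nat \<times> nat \<Rightarrow> complex"
  assumes antisym: "\<And>u v. g (v, u) = - g (u, v)" "\<And>u v. h (v, u) = - h (u, v)"
    and conserved: "\<And>u. (\<Sum>e | e \<in> parcs G \<and> fst e = u. g e) = 0"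
      "\<And>u. (\<Sum>e | e \<in> parcs G \<and> fst e = u. h e) = 0"
    and supports: "{e. g e \<noteq> 0} \<subseteq> parcs G" "{e. h e \<noteq> 0} \<subseteq> parcs G" "{e. g e \<noteq> 0} \<noteq> {}"
      "{e. h e \<noteq> 0} \<noteq> {}" "{e. g e \<noteq> 0} \<noteq> {e. h e \<noteq> 0}"
  shows "n < num_edges G"
proof (rule ccontr)
  define m where "m = num_edges G"
  assume "\<not> n < num_edges G"
  then have mn: "m < Suc n" by (simp add: m_def)
  obtain l where l: "n = Suc l" using n_pos by (cases n) auto
  let ?O = "{(u, v). (u, v) \<in> parcs G \<and> u < v}"
  have m: "m = card ?O"
    unfolding m_def by (rule card_parcs_eq_twice_num_edges(1)) auto
  have "finite ?O" by (rule finite_subset[OF _ pair_finite_arcs]) auto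
  then obtain os where os: "set os = ?O" "distinct os" using finite_distinct_list by blast
  then have len_os: "length os = m" unfolding m by (metis distinct_card)
  \<comment> \<open>One row for each edge \<open>uv\<close> with \<open>u < v\<close>; columns \<open>0\<close> to \<open>l - 1\<close> belong to vertices \<open>1\<close> to \<open>l\<close>.\<close>
  define R :: "complex mat" where "R = mat m (Suc n) (\<lambda>(p, j).
    if j < l then of_bool (fst (os ! p) = Suc j) - of_bool (snd (os ! p) = Suc j)
    else if j = l then g (os ! p) else h (os ! p))"
  have "R \<in> carrier_mat m (Suc n)" by (simp add: R_def)
  from underdetermined_system[OF this mn] obtain y
    where y: "y \<in> carrier_vec (Suc n)" "y \<noteq> 0\<^sub>v (Suc n)" "R *\<^sub>v y = 0\<^sub>v m" by blast
  define x where "x u = (if u < n then y $ (u - 1) else 0)" for u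
  define f where "f e = - (y $ l * g e + y $ n * h e)" for e
  have x_sum: "(\<Sum>j<l. of_bool (u = Suc j) * y $ j) = x u" if "u \<in> {1..n}" for u
  proof -
    have "(\<Sum>j<l. of_bool (u = Suc j) * y $ j) = (\<Sum>j<l. if j = u - 1 then y $ j else 0)"
      using that by (intro sum.cong) auto
    also have "\<dots> = x u" using that l by (auto simp: x_def)
    finally show ?thesis .
  qed
  have oriented: "x u - x v = f (u, v)" if uv: "(u, v) \<in> ?O" for u v
  proof -
    obtain p where p: "p < m" "os ! p = (u, v)" using uv len_os unfolding os(1)[symmetric] in_set_conv_nth by blast
    have in_verts: "u \<in> {1..n}" "v \<in> {1..n}" using uv in_arcsD1 in_arcsD2 verts_eq by auto
    have "0 = (R *\<^sub>v y) $ p" using p y(3) by simp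
    also have "\<dots> = (\<Sum>j<Suc (Suc l). R $$ (p, j) * y $ j)"
      using p y(1) l by (simp add: R_def scalar_prod_def atLeast0LessThan)
    also have "\<dots> = (\<Sum>j<l. R $$ (p, j) * y $ j) + g (u, v) * y $ l + h (u, v) * y $ n"
      using p l by (simp add: R_def)
    also have "(\<Sum>j<l. R $$ (p, j) * y $ j)
        = (\<Sum>j<l. of_bool (u = Suc j) * y $ j - of_bool (v = Suc j) * y $ j)"
      using p l by (intro sum.cong) (auto simp: R_def left_diff_distrib)
    also have "\<dots> = x u - x v"
      unfolding sum_subtractf x_sum[OF in_verts(1)] x_sum[OF in_verts(2)] ..
    finally have "x u - x v + (y $ l * g (u, v) + y $ n * h (u, v)) = 0"
      by (simp only: mult.commute add.assoc)
    then show ?thesis unfolding f_def by (simp only: eq_neg_iff_add_eq_0)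
  qed
  have f_antisym: "f (v, u) = - f (u, v)" for u v
    unfolding f_def antisym(1)[of v u] antisym(2)[of v u] by simp
  have grad: "x u - x v = f (u, v)" if "(u, v) \<in> parcs G" for u v
  proof (cases "u < v")
    case False
    then have "(v, u) \<in> ?O" using that no_loops'[OF that] arcs_symmetric by auto
    then show ?thesis using oriented[of v u] f_antisym[of u v] by (simp add: algebra_simps)
  qed (use oriented that in auto)
  have f_conserved: "(\<Sum>e | e \<in> parcs G \<and> fst e = u. f e) = 0" for u
    unfolding f_def sum_negf sum.distrib sum_distrib_left[symmetric] conserved by simp
  have f_zero: "f e = 0" if "e \<in> parcs G" for e
    using gradient_orthogonal_to_flows[of f x e] f_antisym f_conserved grad that by blast
  have x_arc: "x (fst e) = x (snd e)" if "e \<in> parcs G" for e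
    using grad[of "fst e" "snd e"] f_zero[OF that] that by simp
  have x_zero: "x u = 0" if "u \<in> {1..n}" for u
  proof -
    have "x u = x n"
      by (rule constant_if_arcwise_constant[where f = x]) (use x_arc that verts_eq n_pos in auto)
    then show ?thesis by (simp add: x_def)
  qed
  have relation: "y $ l * g e = - (y $ n * h e)" for e
  proof (cases "e \<in> parcs G")
    case True
    show ?thesis using f_zero[OF True] unfolding f_def neg_equal_0_iff_equal eq_neg_iff_add_eq_0 .
  next
    case False
    then have "g e = 0" "h e = 0" using supports(1,2) by blast+
    then show ?thesis by simp
  qed
  have "y $ l = 0 \<and> y $ n = 0"
  proof (rule ccontr)
    assume "\<not> (y $ l = 0 \<and> y $ n = 0)"
    moreover have "y $ l = 0" if "y $ n = 0" using relation supports(3) that by auto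
    moreover have "y $ n = 0" if "y $ l = 0" using relation supports(4) that by auto
    ultimately have "y $ l \<noteq> 0" "y $ n \<noteq> 0" by auto
    then have "g e \<noteq> 0 \<longleftrightarrow> h e \<noteq> 0" for e using relation[of e] by auto
    then show False using supports(5) by blast
  qed
  moreover have "y $ j = 0" if "j < l" for j
    using x_zero[of "Suc j"] that l by (simp add: x_def)
  ultimately have "y $ j = 0" if "j < Suc n" for j
    using that l by (metis less_Suc_eq)
  then have "y = 0\<^sub>v (Suc n)" using y(1) by (intro eq_vecI) auto
  then show False using y(2) by blast
qed

lemma two_cycles_bound:
  assumes "at_least_two_cycles G"
  shows "n < num_edges G"
proof -
  obtain C C' where CC: "C \<in> cycle_subgraphs G" "C' \<in> cycle_subgraphs G" "C \<noteq> C'"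
    using assms unfolding at_least_two_cycles_def by blast
  obtain g :: "nat \<times> nat \<Rightarrow> complex" where g: "\<And>u v. g (v, u) = - g (u, v)" "\<And>u. (\<Sum>e | e \<in> parcs G \<and> fst e = u. g e) = 0"
    "{e. g e \<noteq> 0} = parcs C" "parcs C \<subseteq> parcs G" "pverts C = fst ` parcs C" "parcs C \<noteq> {}"
    using circulation_of_cycle[OF CC(1)] by blast
  obtain h :: "nat \<times> nat \<Rightarrow> complex" where h: "\<And>u v. h (v, u) = - h (u, v)" "\<And>u. (\<Sum>e | e \<in> parcs G \<and> fst e = u. h e) = 0"
    "{e. h e \<noteq> 0} = parcs C'" "parcs C' \<subseteq> parcs G" "pverts C' = fst ` parcs C'" "parcs C' \<noteq> {}"
    using circulation_of_cycle[OF CC(2)] by blast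
  have "parcs C \<noteq> parcs C'"
    using CC(3) g(5) h(5) by (metis pair_pre_digraph.equality old.unit.exhaust)
  then show ?thesis
    using g(3,4,6) h(3,4,6) by (intro independent_circulations_bound[OF g(1) h(1) g(2) h(2)]) auto
qed

section \<open>Comparison of the Jordan forms\<close>

lemma traces_eq: "sum_list (diag_mat K) = sum_list (diag_mat B)"
proof -
  have "B $$ (p, p) = 0" if "p < N" for p
    using that no_loops'[of "fst (es ! p)" "snd (es ! p)"] nth_es_arc[OF that]
    by (auto simp: nonbacktracking_matrix_def split: prod.splits)
  then have "sum_list (diag_mat B) = 0" by (simp add: diag_mat_def interv_sum_list_conv_sum_set_nat)
  moreover have "A $$ (i, i) = 0" if "i < n" for i
    using that no_loops' by (auto simp: adjacency_matrix_def)
  then have "sum_list (diag_mat A) = 0" by (simp add: diag_mat_def interv_sum_list_conv_sum_set_nat)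
  then have "sum_list (diag_mat K) = 0"
    unfolding K_matrix_def by (subst diag_four_block_mat[of _ n _ n]) (auto simp: sum_list_replicate)
  ultimately show ?thesis by simp
qed

theorem same_jordan_form_B_M:
  assumes "at_least_two_cycles G"
  shows "same_jordan_form B (M_matrix n G)"
proof -
  define d where "d = num_edges G - n"
  have less: "n < num_edges G" by (rule two_cycles_bound[OF assms])
  have "N = card (parcs G)" using distinct_card[OF distinct_es] set_es by simp
  also have "\<dots> = 2 * num_edges G"
    by (rule card_parcs_eq_twice_num_edges(2)[of "(<)"]) auto
  finally have N: "N = (n + n) + 2 * d" and ne: "N \<noteq> 2 * n" using less by (auto simp: d_def)
  have semisimple_K: "char_matrix K s *\<^sub>v v = 0\<^sub>v (n + n)"
    if "s = 1 \<or> s = -1" "v \<in> carrier_vec (n + n)"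
      "char_matrix K s *\<^sub>v (char_matrix K s *\<^sub>v v) = 0\<^sub>v (n + n)" for s v
    by (rule K_semisimple[OF that(1) ne that(2,3)])
  have semisimple_B: "char_matrix B s *\<^sub>v v = 0\<^sub>v N"
    if "s = 1 \<or> s = -1" "v \<in> carrier_vec N" "char_matrix B s *\<^sub>v (char_matrix B s *\<^sub>v v) = 0\<^sub>v N" for s v
    by (rule B_semisimple[OF that(1) ne that(2,3)])
  have "same_jordan_form B (diag_block_mat [K, 1\<^sub>m d, - 1\<^sub>m d])"
    by (rule same_jordan_form_by_intertwining[of K "n + n" B d X Y, folded N, OF carriers(9,8)
          X_carrier Y_carrier B_X K_Y X_Y Y_X])
      (fact semisimple_K semisimple_B traces_eq)+
  then show ?thesis unfolding M_matrix_def d_def Let_def .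
qed

end

theorem theorem2p6:
  fixes G :: "nat pair_pre_digraph" and n :: nat and es :: "(nat \<times> nat) list"
  assumes "pair_graph G"
    and "pverts G = {1..n}"
    and "Digraph_Component.connected (with_proj G)"
    and "at_least_two_cycles G"
    and "distinct es" and "set es = parcs G"
  shows "same_jordan_form (nonbacktracking_matrix es) (M_matrix n G)"
proof -
  interpret connected_listed_graph G n es
    using assms(1,2,3,5,6)
    by (intro connected_listed_graph.intro listed_graph.intro listed_graph_axioms.intro
        connected_listed_graph_axioms.intro)
  show ?thesis by (rule same_jordan_form_B_M[OF assms(4)])
qed

end
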